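(* Let $(M,\omega)$ be a symplectic manifold with an action of a semisimple Lie group $G$ with Lie algebra $\mathfrak{g}$, and let $\mu:M\to\mathfrak{g}^*$ be a moment map for this action. Assume that a group $\Omega$ acts on $M$ by symplectomorphisms, and that $\Omega$ is a subgroup of the outer automorphism group of $G$ (acting on $G$ by automorphisms). Furthermore, assume that the action of $G$ on $M$ lifts to an action of $G\rtimes\Omega$, i.e. $\varpi.(g.x)=(\varpi.g).(\varpi.x)$ for all $\varpi\in\Omega$, $g\in G$, $x\in M$. Then $\mu$ is $\Omega$-equivariant, i.e. $\mu(\varpi.x)=\varpi.\mu(x)$ for all $x\in M$ and $\varpi\in\Omega$.
   Context: A moment map for the $G$-action is a $G$-equivariant map $\mu:M\to\mathfrak{g}^*$ (for the coadjoint action on $\mathfrak{g}^*$) such that $\langle d_x\mu(v),\xi\rangle=\omega_x(V_\xi(x),v)$ for all $x\in M$, $v\in T_xM$, $\xi\in\mathfrak{g}$, where $V_\xi(x)=\frac{d}{dt}\big|_{t=0}\exp(t\xi).x$ and $\langle\cdot,\cdot\rangle$ is the pairing $\mathfrak{g}^*\times\mathfrak{g}\to$ scalars. The action of $\Omega$ on $G$ by automorphisms induces an action on $\mathfrak{g}$ by differentiation, and the action on $\mathfrak{g}^*$ is the dual one: $\langle\varpi.f,\xi\rangle=\langle f,\varpi^{-1}.\xi\rangle$. *)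

theory Defs
  imports
    "HOL-Analysis.Analysis"
    "HOL-Library.Function_Algebras"
    "HOL-Algebra.Coset"
    "HOL-Algebra.Bij"
    "HOL-Algebra.Group_Action"
begin

section \<open>Smooth maps between open subsets of normed spaces\<close>

text \<open>
  On an open subset \<open>S\<close> of a finite-dimensional space, a map is \<open>C\<^sup>n\<^sup>+\<^sup>1\<close> iff it is differentiable
  and all its directional derivatives along fixed vectors are \<open>C\<^sup>n\<close>.
\<close>

primrec Ck_on :: "nat \<Rightarrow> 'a::real_normed_vector set \<Rightarrow> ('a \<Rightarrow> 'b::real_normed_vector) \<Rightarrow> bool" where
  "Ck_on 0 S f \<longleftrightarrow> continuous_on S f"
| "Ck_on (Suc n) S f \<longleftrightarrow>
     (\<forall>x\<in>S. f differentiable (at x)) \<and> (\<forall>v. Ck_on n S (\<lambda>x. frechet_derivative f (at x) v))"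

definition smooth_on :: "'a::real_normed_vector set \<Rightarrow> ('a \<Rightarrow> 'b::real_normed_vector) \<Rightarrow> bool" where
  "smooth_on S f \<longleftrightarrow> (\<forall>n. Ck_on n S f)"


section \<open>Smooth manifolds\<close>

text \<open>
  The model space is a finite-dimensional real Banach space rather than a Euclidean space in the
  sense of the type class \<open>euclidean_space\<close>, because the latter excludes dimension zero.
  A chart is a pair of a domain and a coordinate map; only the values of the coordinate map on the
  domain matter.
\<close>

type_synonym ('a, 'e) chart = "'a set \<times> ('a \<Rightarrow> 'e)"

record ('a, 'e) manifold =
  mtop :: "'a topology"
  atlas :: "('a, 'e) chart set"

abbreviation points :: "('a, 'e) manifold \<Rightarrow> 'a set" where
  "points M \<equiv> topspace (mtop M)"

definition chart_inv :: "('a, 'e) chart \<Rightarrow> 'e \<Rightarrow> 'a" where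
  "chart_inv c = inv_into (fst c) (snd c)"

definition charts_at :: "('a, 'e) manifold \<Rightarrow> 'a \<Rightarrow> ('a, 'e) chart set" where
  "charts_at M x = {c \<in> atlas M. x \<in> fst c}"

definition smooth_manifold :: "('a, 'e::banach) manifold \<Rightarrow> bool" where
  "smooth_manifold M \<longleftrightarrow>
     (\<exists>B::'e set. finite B \<and> span B = UNIV) \<and>
     Hausdorff_space (mtop M) \<and> second_countable (mtop M) \<and>
     (\<forall>c \<in> atlas M. openin (mtop M) (fst c) \<and> open (snd c ` fst c) \<and>
        homeomorphic_map (subtopology (mtop M) (fst c)) (top_of_set (snd c ` fst c)) (snd c)) \<and>
     (\<Union>c \<in> atlas M. fst c) = points M \<and>
     (\<forall>c \<in> atlas M. \<forall>d \<in> atlas M. smooth_on (snd c ` (fst c \<inter> fst d)) (snd d \<circ> chart_inv c))"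

definition prod_manifold ::
  "('a, 'e) manifold \<Rightarrow> ('b, 'f) manifold \<Rightarrow> ('a \<times> 'b, 'e \<times> 'f) manifold" where
  "prod_manifold M N =
     \<lparr>mtop = prod_topology (mtop M) (mtop N),
      atlas = {(fst c \<times> fst d, map_prod (snd c) (snd d)) | c d. c \<in> atlas M \<and> d \<in> atlas N}\<rparr>"

definition smooth_map ::
  "('a, 'e::banach) manifold \<Rightarrow> ('b, 'f::banach) manifold \<Rightarrow> ('a \<Rightarrow> 'b) \<Rightarrow> bool" where
  "smooth_map M N f \<longleftrightarrow> continuous_map (mtop M) (mtop N) f \<and>
     (\<forall>c \<in> atlas M. \<forall>d \<in> atlas N.
        smooth_on (snd c ` {x \<in> fst c. f x \<in> fst d}) (snd d \<circ> f \<circ> chart_inv c))"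

definition smooth_fun :: "('a, 'e::banach) manifold \<Rightarrow> ('a \<Rightarrow> 'b::real_normed_vector) \<Rightarrow> bool" where
  "smooth_fun M F \<longleftrightarrow> (\<forall>c \<in> atlas M. smooth_on (snd c ` fst c) (F \<circ> chart_inv c))"


section \<open>Tangent vectors\<close>

text \<open>
  Pointwise scalar multiplication; together with \<open>Function_Algebras\<close> it makes \<open>subspace\<close> and
  \<open>span\<close> available for tangent spaces.
\<close>

instantiation "fun" :: (type, real_vector) real_vector
begin

definition scaleR_fun :: "real \<Rightarrow> ('a \<Rightarrow> 'b) \<Rightarrow> 'a \<Rightarrow> 'b" where
  "scaleR_fun r f = (\<lambda>x. r *\<^sub>R f x)"

instance
  by standard (simp_all add: scaleR_fun_def fun_eq_iff scaleR_add_right scaleR_add_left)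

end

text \<open>
  A tangent vector at \<open>x\<close> is the family of its coordinate representations in the charts around
  \<open>x\<close>, related by the derivatives of the transition maps, and zero by convention on all other
  pairs.
\<close>

type_synonym ('a, 'e) tvec = "('a, 'e) chart \<Rightarrow> 'e"

definition tangent_space :: "('a, 'e::banach) manifold \<Rightarrow> 'a \<Rightarrow> ('a, 'e) tvec set" where
  "tangent_space M x =
     {w. (\<forall>c. c \<notin> charts_at M x \<longrightarrow> w c = 0) \<and>
         (\<forall>c \<in> charts_at M x. \<forall>d \<in> charts_at M x.
            w d = frechet_derivative (snd d \<circ> chart_inv c) (at (snd c x)) (w c))}"

text \<open>The tangent vector at \<open>x\<close> whose representation in the chart \<open>c\<close> is \<open>u\<close>.\<close>

definition coord_vec ::
  "('a, 'e::banach) manifold \<Rightarrow> ('a, 'e) chart \<Rightarrow> 'a \<Rightarrow> 'e \<Rightarrow> ('a, 'e) tvec" where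
  "coord_vec M c x u =
     (\<lambda>d. if d \<in> charts_at M x
          then frechet_derivative (snd d \<circ> chart_inv c) (at (snd c x)) u else 0)"

text \<open>The differential at \<open>x\<close> of a vector-valued function; it does not depend on the chart.\<close>

definition diff_fun ::
  "('a, 'e::banach) manifold \<Rightarrow> ('a \<Rightarrow> 'b::real_normed_vector) \<Rightarrow> 'a \<Rightarrow> ('a, 'e) tvec \<Rightarrow> 'b" where
  "diff_fun M F x v =
     (let c = (SOME c. c \<in> charts_at M x)
      in frechet_derivative (F \<circ> chart_inv c) (at (snd c x)) (v c))"

definition tangent_map ::
  "('a, 'e::banach) manifold \<Rightarrow> ('b, 'f::banach) manifold \<Rightarrow> ('a \<Rightarrow> 'b) \<Rightarrow> 'a
     \<Rightarrow> ('a, 'e) tvec \<Rightarrow> ('b, 'f) tvec" where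
  "tangent_map M N f x v =
     (\<lambda>d. if d \<in> charts_at N (f x) then diff_fun M (snd d \<circ> f) x v else 0)"

definition has_velocity ::
  "('a, 'e::banach) manifold \<Rightarrow> (real \<Rightarrow> 'a) \<Rightarrow> real \<Rightarrow> ('a, 'e) tvec \<Rightarrow> bool" where
  "has_velocity M \<gamma> t w \<longleftrightarrow> w \<in> tangent_space M (\<gamma> t) \<and>
     (\<forall>d \<in> charts_at M (\<gamma> t). ((snd d \<circ> \<gamma>) has_vector_derivative w d) (at t))"

definition velocity ::
  "('a, 'e::banach) manifold \<Rightarrow> (real \<Rightarrow> 'a) \<Rightarrow> real \<Rightarrow> ('a, 'e) tvec" where
  "velocity M \<gamma> t =
     (\<lambda>d. if d \<in> charts_at M (\<gamma> t) then vector_derivative (snd d \<circ> \<gamma>) (at t) else 0)"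


section \<open>Symplectic manifolds\<close>

type_synonym ('a, 'e) two_form = "'a \<Rightarrow> ('a, 'e) tvec \<Rightarrow> ('a, 'e) tvec \<Rightarrow> real"

text \<open>The component of \<open>\<omega>\<close> along the constant coordinate fields \<open>u\<close>, \<open>v\<close> of the chart \<open>c\<close>.\<close>

definition local_form ::
  "('a, 'e::banach) manifold \<Rightarrow> ('a, 'e) two_form \<Rightarrow> ('a, 'e) chart \<Rightarrow> 'e \<Rightarrow> 'e \<Rightarrow> 'e \<Rightarrow> real" where
  "local_form M \<omega> c u v p =
     (let x = chart_inv c p in \<omega> x (coord_vec M c x u) (coord_vec M c x v))"

definition differential_two_form :: "('a, 'e::banach) manifold \<Rightarrow> ('a, 'e) two_form \<Rightarrow> bool" where
  "differential_two_form M \<omega> \<longleftrightarrow>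
     (\<forall>x \<in> points M. \<forall>u \<in> tangent_space M x. \<forall>v \<in> tangent_space M x.
        \<omega> x u v = - \<omega> x v u \<and>
        (\<forall>w \<in> tangent_space M x. \<omega> x (u + v) w = \<omega> x u w + \<omega> x v w) \<and>
        (\<forall>r. \<omega> x (r *\<^sub>R u) v = r * \<omega> x u v)) \<and>
     (\<forall>c \<in> atlas M. \<forall>u v. smooth_on (snd c ` fst c) (local_form M \<omega> c u v))"

text \<open>
  \<open>d\<omega> = 0\<close>, evaluated on constant coordinate fields, whose Lie brackets vanish.
\<close>

definition closed_two_form :: "('a, 'e::banach) manifold \<Rightarrow> ('a, 'e) two_form \<Rightarrow> bool" where
  "closed_two_form M \<omega> \<longleftrightarrow>
     (\<forall>c \<in> atlas M. \<forall>p \<in> snd c ` fst c. \<forall>u v w.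
        frechet_derivative (local_form M \<omega> c v w) (at p) u
        + frechet_derivative (local_form M \<omega> c w u) (at p) v
        + frechet_derivative (local_form M \<omega> c u v) (at p) w = 0)"

definition nondegenerate_two_form :: "('a, 'e::banach) manifold \<Rightarrow> ('a, 'e) two_form \<Rightarrow> bool" where
  "nondegenerate_two_form M \<omega> \<longleftrightarrow>
     (\<forall>x \<in> points M. \<forall>u \<in> tangent_space M x.
        (\<forall>v \<in> tangent_space M x. \<omega> x u v = 0) \<longrightarrow> u = 0)"

definition symplectic_manifold :: "('a, 'e::banach) manifold \<Rightarrow> ('a, 'e) two_form \<Rightarrow> bool" where
  "symplectic_manifold M \<omega> \<longleftrightarrow> smooth_manifold M \<and> differential_two_form M \<omega> \<and>
     closed_two_form M \<omega> \<and> nondegenerate_two_form M \<omega>"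

definition symplectomorphism ::
  "('a, 'e::banach) manifold \<Rightarrow> ('a, 'e) two_form \<Rightarrow> ('a \<Rightarrow> 'a) \<Rightarrow> bool" where
  "symplectomorphism M \<omega> f \<longleftrightarrow> bij_betw f (points M) (points M) \<and>
     smooth_map M M f \<and> smooth_map M M (inv_into (points M) f) \<and>
     (\<forall>x \<in> points M. \<forall>v \<in> tangent_space M x. \<forall>w \<in> tangent_space M x.
        \<omega> (f x) (tangent_map M M f x v) (tangent_map M M f x w) = \<omega> x v w)"


section \<open>Lie groups\<close>

record ('g, 'e) lie_group_data = "'g monoid" +
  mfd :: "('g, 'e) manifold"

definition lie_group :: "('g, 'e::banach) lie_group_data \<Rightarrow> bool" where
  "lie_group G \<longleftrightarrow> group G \<and> smooth_manifold (mfd G) \<and> points (mfd G) = carrier G \<and>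
     smooth_map (prod_manifold (mfd G) (mfd G)) (mfd G) (\<lambda>(g, h). g \<otimes>\<^bsub>G\<^esub> h) \<and>
     smooth_map (mfd G) (mfd G) (\<lambda>g. inv\<^bsub>G\<^esub> g)"

definition lie_algebra :: "('g, 'e::banach) lie_group_data \<Rightarrow> ('g, 'e) tvec set" where
  "lie_algebra G = tangent_space (mfd G) \<one>\<^bsub>G\<^esub>"

definition Ad ::
  "('g, 'e::banach) lie_group_data \<Rightarrow> 'g \<Rightarrow> ('g, 'e) tvec \<Rightarrow> ('g, 'e) tvec" where
  "Ad G g = tangent_map (mfd G) (mfd G) (\<lambda>h. g \<otimes>\<^bsub>G\<^esub> h \<otimes>\<^bsub>G\<^esub> inv\<^bsub>G\<^esub> g) \<one>\<^bsub>G\<^esub>"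

text \<open>
  The bracket is \<open>[\<xi>, \<eta>] = ad \<xi> \<eta>\<close>, where \<open>ad\<close> is the differential of \<open>Ad\<close> at the identity;
  the differential of the \<open>\<gg>\<close>-valued map \<open>g \<mapsto> Ad g \<eta>\<close> is taken in each component.
\<close>

definition lie_bracket ::
  "('g, 'e::banach) lie_group_data \<Rightarrow> ('g, 'e) tvec \<Rightarrow> ('g, 'e) tvec \<Rightarrow> ('g, 'e) tvec" where
  "lie_bracket G \<xi> \<eta> = (\<lambda>d. diff_fun (mfd G) (\<lambda>g. Ad G g \<eta> d) \<one>\<^bsub>G\<^esub> \<xi>)"

definition one_parameter_subgroup ::
  "('g, 'e::banach) lie_group_data \<Rightarrow> (real \<Rightarrow> 'g) \<Rightarrow> bool" where
  "one_parameter_subgroup G \<gamma> \<longleftrightarrow> continuous_map euclideanreal (mtop (mfd G)) \<gamma> \<and>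
     (\<forall>s t. \<gamma> (s + t) = \<gamma> s \<otimes>\<^bsub>G\<^esub> \<gamma> t)"

definition lie_exp :: "('g, 'e::banach) lie_group_data \<Rightarrow> ('g, 'e) tvec \<Rightarrow> 'g" where
  "lie_exp G \<xi> = (THE \<gamma>. one_parameter_subgroup G \<gamma> \<and> has_velocity (mfd G) \<gamma> 0 \<xi>) 1"


section \<open>Semisimplicity\<close>

text \<open>
  The next three notions concern a subspace \<open>L\<close> of a real vector space that is a Lie algebra under
  a bracket \<open>br\<close>. A Lie algebra is simple if it is not abelian and has no ideals besides zero and
  itself, and semisimple if it is a (finite, possibly empty) direct sum of simple ideals.
\<close>

definition lie_ideal :: "('v::real_vector \<Rightarrow> 'v \<Rightarrow> 'v) \<Rightarrow> 'v set \<Rightarrow> 'v set \<Rightarrow> bool" where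
  "lie_ideal br L I \<longleftrightarrow> subspace I \<and> I \<subseteq> L \<and> (\<forall>x \<in> L. \<forall>y \<in> I. br x y \<in> I)"

definition simple_lie_algebra :: "('v::real_vector \<Rightarrow> 'v \<Rightarrow> 'v) \<Rightarrow> 'v set \<Rightarrow> bool" where
  "simple_lie_algebra br L \<longleftrightarrow> (\<exists>x \<in> L. \<exists>y \<in> L. br x y \<noteq> 0) \<and>
     (\<forall>I. lie_ideal br L I \<longrightarrow> I = {0} \<or> I = L)"

definition semisimple_lie_algebra :: "('v::real_vector \<Rightarrow> 'v \<Rightarrow> 'v) \<Rightarrow> 'v set \<Rightarrow> bool" where
  "semisimple_lie_algebra br L \<longleftrightarrow>
     (\<exists>\<I>. finite \<I> \<and> (\<forall>I \<in> \<I>. lie_ideal br L I \<and> simple_lie_algebra br I) \<and>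
          span (\<Union>\<I>) = L \<and> (\<forall>I \<in> \<I>. I \<inter> span (\<Union>(\<I> - {I})) = {0}))"

definition semisimple_lie_group :: "('g, 'e::banach) lie_group_data \<Rightarrow> bool" where
  "semisimple_lie_group G \<longleftrightarrow>
     lie_group G \<and> semisimple_lie_algebra (lie_bracket G) (lie_algebra G)"


section \<open>Outer automorphisms\<close>

text \<open>
  An outer automorphism is a coset of Lie group automorphisms. A group of outer automorphisms has
  no canonical action on \<open>G\<close>: an action by automorphisms is a homomorphism into \<open>lie_aut G\<close> that
  picks a representative of every coset.
\<close>

definition lie_aut :: "('g, 'e::banach) lie_group_data \<Rightarrow> ('g \<Rightarrow> 'g) monoid" where
  "lie_aut G = BijGroup (carrier G)
     \<lparr>carrier := {f \<in> auto G. smooth_map (mfd G) (mfd G) f \<and>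
                               smooth_map (mfd G) (mfd G) (inv_into (carrier G) f)}\<rparr>"

definition inner_auts :: "('g, 'e::banach) lie_group_data \<Rightarrow> ('g \<Rightarrow> 'g) set" where
  "inner_auts G = (\<lambda>g. \<lambda>h\<in>carrier G. g \<otimes>\<^bsub>G\<^esub> h \<otimes>\<^bsub>G\<^esub> inv\<^bsub>G\<^esub> g) ` carrier G"

definition outer_aut :: "('g, 'e::banach) lie_group_data \<Rightarrow> ('g \<Rightarrow> 'g) set monoid" where
  "outer_aut G = lie_aut G Mod inner_auts G"


section \<open>Moment maps\<close>

text \<open>Functionals are restricted to the Lie algebra so that equality in the dual is equality in HOL.\<close>

definition dual_lie_algebra ::
  "('g, 'e::banach) lie_group_data \<Rightarrow> (('g, 'e) tvec \<Rightarrow> real) set" where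
  "dual_lie_algebra G =
     {f \<in> extensional (lie_algebra G).
        (\<forall>\<xi> \<in> lie_algebra G. \<forall>\<eta> \<in> lie_algebra G. f (\<xi> + \<eta>) = f \<xi> + f \<eta>) \<and>
        (\<forall>r. \<forall>\<xi> \<in> lie_algebra G. f (r *\<^sub>R \<xi>) = r * f \<xi>)}"

definition coadjoint ::
  "('g, 'e::banach) lie_group_data \<Rightarrow> 'g \<Rightarrow> (('g, 'e) tvec \<Rightarrow> real) \<Rightarrow> ('g, 'e) tvec \<Rightarrow> real" where
  "coadjoint G g f = (\<lambda>\<xi> \<in> lie_algebra G. f (Ad G (inv\<^bsub>G\<^esub> g) \<xi>))"

definition smooth_action ::
  "('g, 'f::banach) lie_group_data \<Rightarrow> ('a, 'e::banach) manifold \<Rightarrow> ('g \<Rightarrow> 'a \<Rightarrow> 'a) \<Rightarrow> bool" where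
  "smooth_action G M \<alpha> \<longleftrightarrow> group_action G (points M) \<alpha> \<and>
     smooth_map (prod_manifold (mfd G) M) M (\<lambda>(g, x). \<alpha> g x)"

definition action_field ::
  "('g, 'f::banach) lie_group_data \<Rightarrow> ('a, 'e::banach) manifold \<Rightarrow> ('g \<Rightarrow> 'a \<Rightarrow> 'a)
     \<Rightarrow> ('g, 'f) tvec \<Rightarrow> 'a \<Rightarrow> ('a, 'e) tvec" where
  "action_field G M \<alpha> \<xi> x = velocity M (\<lambda>t. \<alpha> (lie_exp G (t *\<^sub>R \<xi>)) x) 0"

text \<open>
  Smoothness and the differential of \<open>\<mu>\<close> are expressed through the coordinate functions
  \<open>\<langle>\<mu>, \<xi>\<rangle>\<close> on the finite-dimensional dual.
\<close>

definition dual_diff ::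
  "('g, 'f::banach) lie_group_data \<Rightarrow> ('a, 'e::banach) manifold
     \<Rightarrow> ('a \<Rightarrow> ('g, 'f) tvec \<Rightarrow> real) \<Rightarrow> 'a \<Rightarrow> ('a, 'e) tvec \<Rightarrow> ('g, 'f) tvec \<Rightarrow> real" where
  "dual_diff G M \<mu> x v = (\<lambda>\<xi> \<in> lie_algebra G. diff_fun M (\<lambda>y. \<mu> y \<xi>) x v)"

definition moment_map ::
  "('g, 'f::banach) lie_group_data \<Rightarrow> ('a, 'e::banach) manifold \<Rightarrow> ('a, 'e) two_form
     \<Rightarrow> ('g \<Rightarrow> 'a \<Rightarrow> 'a) \<Rightarrow> ('a \<Rightarrow> ('g, 'f) tvec \<Rightarrow> real) \<Rightarrow> bool" where
  "moment_map G M \<omega> \<alpha> \<mu> \<longleftrightarrow>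
     \<mu> \<in> points M \<rightarrow> dual_lie_algebra G \<and>
     (\<forall>\<xi> \<in> lie_algebra G. smooth_fun M (\<lambda>x. \<mu> x \<xi>)) \<and>
     (\<forall>g \<in> carrier G. \<forall>x \<in> points M. \<mu> (\<alpha> g x) = coadjoint G g (\<mu> x)) \<and>
     (\<forall>x \<in> points M. \<forall>v \<in> tangent_space M x. \<forall>\<xi> \<in> lie_algebra G.
        dual_diff G M \<mu> x v \<xi> = \<omega> x (action_field G M \<alpha> \<xi> x) v)"

text \<open>
  For an action \<open>\<sigma>\<close> of a group \<open>W\<close> on \<open>G\<close> by automorphisms, the induced action on the Lie algebra
  and the dual action.
\<close>

definition aut_lie_algebra ::
  "('g, 'e::banach) lie_group_data \<Rightarrow> ('w \<Rightarrow> 'g \<Rightarrow> 'g) \<Rightarrow> 'w \<Rightarrow> ('g, 'e) tvec \<Rightarrow> ('g, 'e) tvec" where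
  "aut_lie_algebra G \<sigma> w = tangent_map (mfd G) (mfd G) (\<sigma> w) \<one>\<^bsub>G\<^esub>"

definition aut_dual ::
  "('g, 'e::banach) lie_group_data \<Rightarrow> ('w, 'z) monoid_scheme \<Rightarrow> ('w \<Rightarrow> 'g \<Rightarrow> 'g) \<Rightarrow> 'w
     \<Rightarrow> (('g, 'e) tvec \<Rightarrow> real) \<Rightarrow> ('g, 'e) tvec \<Rightarrow> real" where
  "aut_dual G W \<sigma> w f = (\<lambda>\<xi> \<in> lie_algebra G. f (aut_lie_algebra G \<sigma> (inv\<^bsub>W\<^esub> w) \<xi>))"

end

theory Submission
  imports Defs
begin

text \<open>
  Write \<open>V\<^sub>\<xi>\<close> for the vector field of \<open>\<xi>\<close>. Differentiating the equivariance
  \<open>\<langle>\<mu> (exp (t \<eta>). x), \<xi>\<rangle> = \<langle>\<mu> x, Ad (exp (- t \<eta>)) \<xi>\<rangle>\<close> at \<open>t = 0\<close> and using the moment map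
  equation on the left-hand side gives

    \<open>\<langle>\<mu> x, [\<eta>, \<xi>]\<rangle> = - \<omega>\<^sub>x (V\<^sub>\<xi> x, V\<^sub>\<eta> x)\<close>   (lemma \<open>moment_map_bracket\<close>).

  So on brackets \<open>\<mu>\<close> is determined by \<open>\<omega>\<close> and the action. The right-hand side is invariant
  under \<open>\<Omega>\<close>: an element \<open>w\<close> preserves \<open>\<omega>\<close>, and since it intertwines the action of \<open>g\<close> with that of
  \<open>w.g\<close>, its differential maps \<open>V\<^sub>\<xi>\<close> at \<open>x\<close> to the field of \<open>w.\<xi>\<close> at \<open>w.x\<close>. Hence \<open>\<mu> (w.x)\<close> and
  \<open>w.(\<mu> x)\<close> agree on all brackets. Semisimplicity makes the brackets span the Lie algebra
  (\<open>semisimple_span_brackets\<close>): in a simple ideal the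
  span of the brackets is a nonzero ideal.

  What needs work is the calculus behind \<open>exp\<close>. The exponential map is the value at time one of
  the unique one-parameter subgroup with a given velocity, so its existence and uniqueness must
  be established. In a chart \<open>c\<close> at the identity, one-parameter subgroups are the integral curves of
  a left-invariant vector field. Finite-dimensionality makes that field locally Lipschitz
  (\<open>left_field_lipschitz\<close>), so a contraction argument yields a unique short integral curve;
  invariance of the field turns it into a local homomorphism (\<open>one_parameter_local\<close>), and
  \<open>t \<mapsto> \<gamma> (t / n)\<^sup>n\<close> extends it to the whole line (\<open>local_hom_extends\<close>).
  Finally the map \<open>g \<mapsto> Ad g \<xi>\<close> is differentiable at the identity (\<open>Ad_chart_differentiable\<close>), so the bracket
  is its derivative along one-parameter subgroups (\<open>lie_bracket_derivative\<close>).

  Identities between tangent maps are obtained throughout by computing the velocity of one curve in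
  two ways (\<open>push_velocity\<close>, \<open>has_velocity_unique\<close>).
\<close>

section \<open>Germs and derivatives\<close>

lemma has_derivative_cong_nhds:
  assumes "\<forall>\<^sub>F p in nhds p0. f p = g p" and "(g has_derivative D) (at p0)"
  shows "(f has_derivative D) (at p0)"
proof -
  have "f p0 = g p0" using assms(1) by (rule eventually_nhds_x_imp_x)
  moreover have "\<forall>\<^sub>F p in at p0. g p = f p"
    using assms(1) by (auto simp: eventually_at_filter elim: eventually_mono)
  ultimately show ?thesis
    by (intro has_derivative_transform_eventually[OF assms(2)]) auto
qed

lemma differentiable_cong_nhds:
  assumes "\<forall>\<^sub>F p in nhds p0. f p = g p" and "g differentiable (at p0)"
  shows "f differentiable (at p0)"
  using assms has_derivative_cong_nhds unfolding differentiable_def by blast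

lemma has_vector_derivative_cong_nhds:
  assumes "\<forall>\<^sub>F s in nhds t. f s = g s" and "(g has_vector_derivative D) (at t)"
  shows "(f has_vector_derivative D) (at t)"
  using assms has_derivative_cong_nhds unfolding has_vector_derivative_def by blast

lemma vector_derivative_chain:
  assumes "(y has_vector_derivative v) (at t)" "(f has_derivative D) (at (y t))"
  shows "((\<lambda>s. f (y s)) has_vector_derivative D v) (at t)"
proof -
  have "linear D" using assms(2) has_derivative_linear by blast
  then show ?thesis
    using has_derivative_compose[of y "\<lambda>h. h *\<^sub>R v" t UNIV f D] assms
    by (simp add: has_vector_derivative_def linear_scale)
qed

lemma has_vector_derivative_shift_at:
  assumes "(f has_vector_derivative D) (at (s + t :: real))"
  shows "((\<lambda>x. f (s + x)) has_vector_derivative D) (at t)"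
proof -
  have "((\<lambda>x. s + x) has_vector_derivative 1) (at t)" by (auto intro!: derivative_eq_intros)
  from vector_diff_chain_at[OF this assms] show ?thesis by (simp add: o_def)
qed

lemma vector_derivative_bound:
  fixes g :: "real \<Rightarrow> 'e::real_normed_vector"
  assumes "convex S" "\<And>x. x \<in> S \<Longrightarrow> (g has_vector_derivative g' x) (at x within S)"
    and "\<And>x. x \<in> S \<Longrightarrow> norm (g' x) \<le> B" "x \<in> S" "y \<in> S"
  shows "norm (g x - g y) \<le> B * \<bar>x - y\<bar>"
proof -
  have "onorm (\<lambda>h. h *\<^sub>R g' z) \<le> B" if "z \<in> S" for z
    using assms(3)[OF that]
    by (intro onorm_le) (simp add: mult.commute[of _ "norm (g' z)"] mult_right_mono)
  then show ?thesis
    using differentiable_bound[of S g "\<lambda>x h. h *\<^sub>R g' x" B x y] assms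
    by (simp add: has_vector_derivative_def)
qed

lemma eventually_near_zero:
  assumes "\<forall>\<^sub>F t in nhds (0::real). P t"
  obtains a where "a > 0" "\<And>t. \<bar>t\<bar> \<le> a \<Longrightarrow> P t"
proof -
  obtain e where e: "e > 0" "\<And>t. dist t 0 < e \<Longrightarrow> P t"
    using assms unfolding eventually_nhds_metric by blast
  show ?thesis by (rule that[of "e/2"]) (use e in auto)
qed

lemma eventually_tendsto_nhds:
  assumes "\<forall>\<^sub>F p in nhds (y t). P p" "isCont y t"
  shows "\<forall>\<^sub>F s in nhds t. P (y s)"
proof -
  have "(y \<longlongrightarrow> y t) (nhds t)"
    using assms(2) unfolding continuous_within using tendsto_at_iff_tendsto_nhds by blast
  then show ?thesis using assms(1) by (simp add: filterlim_iff)
qed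

lemma open_if_eventually:
  assumes "\<And>x. x \<in> S \<Longrightarrow> \<forall>\<^sub>F y in nhds x. y \<in> S"
  shows "open S"
proof (rule open_subopen[THEN iffD2], rule ballI)
  fix x assume "x \<in> S"
  then obtain T where "open T" "x \<in> T" "\<forall>y\<in>T. y \<in> S"
    using assms unfolding eventually_nhds by blast
  then show "\<exists>T. open T \<and> x \<in> T \<and> T \<subseteq> S" by blast
qed

lemma prod_topology_neighbourhood:
  assumes "openin (prod_topology X Y) S" "(x, y) \<in> S"
  shows "\<exists>A B. openin X A \<and> openin Y B \<and> x \<in> A \<and> y \<in> B \<and> A \<times> B \<subseteq> S"
  using assms by (simp add: openin_prod_topology_alt)

section \<open>Finite-dimensional spaces\<close>

text \<open>
  By induction on the basis: boundedness for \<open>B\<close> makes \<open>span B\<close> complete, hence closed, so a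
  new vector \<open>a\<close> outside it has positive distance to it, and this distance bounds the coefficient of \<open>a\<close>.
\<close>

lemma coordinates_bounded:
  fixes B :: "'e::banach set"
  assumes "finite B" "independent B"
  shows "\<exists>C\<ge>0. \<forall>c. \<forall>b\<in>B. \<bar>c b\<bar> \<le> C * norm (\<Sum>b\<in>B. c b *\<^sub>R b)"
  using assms
proof (induction B rule: finite_induct)
  case empty
  then show ?case by (intro exI[of _ 0]) auto
next
  case (insert a B)
  have aB: "a \<notin> span B" and indB: "independent B"
    using insert by (auto simp: independent_insert)
  then obtain C where C0: "C \<ge> 0"
    and C: "\<And>c b. b \<in> B \<Longrightarrow> \<bar>c b\<bar> \<le> C * norm (\<Sum>b\<in>B. c b *\<^sub>R b)"
    using insert.IH by blast
  have "closed (span B)"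
    unfolding closed_sequential_limits
  proof (intro allI impI, elim conjE)
    fix X :: "nat \<Rightarrow> 'e" and l
    assume "\<forall>n. X n \<in> span B" and lim: "X \<longlonglongrightarrow> l"
    then have "\<forall>n. \<exists>c. X n = (\<Sum>b\<in>B. c b *\<^sub>R b)"
      using span_finite[OF insert.hyps(1)] by auto
    then obtain c where c: "\<And>n. X n = (\<Sum>b\<in>B. c n b *\<^sub>R b)" by metis
    have X: "Cauchy X" using lim by (rule LIMSEQ_imp_Cauchy)
    have "convergent (\<lambda>n. c n b)" if b: "b \<in> B" for b
    proof -
      have "Cauchy (\<lambda>n. c n b)"
      proof (rule metric_CauchyI)
        fix e :: real assume "e > 0"
        then have "e / (C + 1) > 0" using C0 by simp
        then obtain N where N: "\<And>m n. m \<ge> N \<Longrightarrow> n \<ge> N \<Longrightarrow> dist (X m) (X n) < e / (C + 1)"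
          using X unfolding Cauchy_def by blast
        have "dist (c m b) (c n b) < e" if "m \<ge> N" "n \<ge> N" for m n
        proof -
          have "\<bar>c m b - c n b\<bar> \<le> C * norm (\<Sum>b\<in>B. (c m b - c n b) *\<^sub>R b)"
            using C[OF b, of "\<lambda>b. c m b - c n b"] .
          also have "(\<Sum>b\<in>B. (c m b - c n b) *\<^sub>R b) = X m - X n"
            by (simp add: c scaleR_diff_left sum_subtractf)
          also have "C * norm (X m - X n) \<le> (C + 1) * norm (X m - X n)"
            by (rule mult_right_mono) auto
          also have "\<dots> < e"
            using N[OF that] C0 by (simp add: dist_norm field_simps)
          finally show ?thesis by (simp add: dist_real_def)
        qed
        then show "\<exists>N. \<forall>m\<ge>N. \<forall>n\<ge>N. dist (c m b) (c n b) < e" by blast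
      qed
      then show ?thesis by (rule Cauchy_convergent)
    qed
    then obtain k where k: "\<And>b. b \<in> B \<Longrightarrow> (\<lambda>n. c n b) \<longlonglongrightarrow> k b"
      unfolding convergent_def by metis
    have "(\<lambda>n. \<Sum>b\<in>B. c n b *\<^sub>R b) \<longlonglongrightarrow> (\<Sum>b\<in>B. k b *\<^sub>R b)"
      by (intro tendsto_intros k)
    then have "X \<longlonglongrightarrow> (\<Sum>b\<in>B. k b *\<^sub>R b)" by (simp add: c[abs_def])
    then have "l = (\<Sum>b\<in>B. k b *\<^sub>R b)" using lim LIMSEQ_unique by blast
    then show "l \<in> span B" by (simp add: span_base span_scale span_sum)
  qed
  then obtain e where e: "e > 0" and ball: "ball a e \<subseteq> - span B"
    using aB by (metis ComplI open_Compl open_contains_ball)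
  have far: "\<bar>r\<bar> * e \<le> norm (r *\<^sub>R a + y)" if y: "y \<in> span B" for r y
  proof (cases "r = 0")
    case False
    have "- ((1/r) *\<^sub>R y) \<in> span B" using y by (simp add: span_neg span_scale)
    then have "\<not> dist a (- ((1/r) *\<^sub>R y)) < e" using ball by (auto simp: subset_iff)
    then have "e \<le> norm (a + (1/r) *\<^sub>R y)" by (simp add: dist_norm)
    then have "\<bar>r\<bar> * e \<le> \<bar>r\<bar> * norm (a + (1/r) *\<^sub>R y)" by (simp add: mult_left_mono)
    also have "\<dots> = norm (r *\<^sub>R (a + (1/r) *\<^sub>R y))" by simp
    also have "r *\<^sub>R (a + (1/r) *\<^sub>R y) = r *\<^sub>R a + y" using False by (simp add: scaleR_add_right)
    finally show ?thesis .
  qed simp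
  \<comment> \<open>the terms bound the new coefficient and, after subtracting its contribution, the old ones\<close>
  define K where "K = 1/e + C * (1 + norm a / e)"
  have K0: "K \<ge> 0" using e C0 by (simp add: K_def)
  have "\<bar>c b\<bar> \<le> K * norm (\<Sum>b\<in>insert a B. c b *\<^sub>R b)" if b: "b \<in> insert a B" for c b
  proof -
    define y where "y = (\<Sum>b\<in>B. c b *\<^sub>R b)"
    define N where "N = norm (\<Sum>b\<in>insert a B. c b *\<^sub>R b)"
    have s: "(\<Sum>b\<in>insert a B. c b *\<^sub>R b) = c a *\<^sub>R a + y"
      using insert.hyps by (simp add: y_def)
    have "y \<in> span B" by (simp add: y_def span_base span_scale span_sum)
    from far[OF this, of "c a"] have a1: "\<bar>c a\<bar> \<le> 1/e * N"
      using e by (simp add: N_def s field_simps)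
    have N0: "N \<ge> 0" by (simp add: N_def)
    show ?thesis
    proof (cases "b = a")
      case True
      have "1/e * N \<le> K * N"
        using N0 C0 e by (intro mult_right_mono) (auto simp: K_def)
      then show ?thesis using a1 True by (simp add: N_def)
    next
      case False
      then have "b \<in> B" using b by simp
      then have "\<bar>c b\<bar> \<le> C * norm y" using C[of b c] by (simp add: y_def)
      also have "norm y \<le> N + \<bar>c a\<bar> * norm a"
        using norm_triangle_ineq4[of "c a *\<^sub>R a + y" "c a *\<^sub>R a"] by (simp add: N_def s)
      also have "N + \<bar>c a\<bar> * norm a \<le> N + (1/e * N) * norm a"
        using a1 by (intro add_left_mono mult_right_mono) auto
      also have "\<dots> = (1 + norm a / e) * N" by (simp add: algebra_simps)
      finally have "\<bar>c b\<bar> \<le> C * ((1 + norm a / e) * N)" using C0 by (simp add: mult_left_mono)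
      also have "\<dots> \<le> K * N" using e N0 by (simp add: K_def algebra_simps)
      finally show ?thesis by (simp add: N_def)
    qed
  qed
  then show ?case using K0 by blast
qed

lemma finite_dim_coordinates:
  assumes "\<exists>B::'e set. finite B \<and> span B = UNIV"
  shows "\<exists>(B::'e::banach set) r. finite B \<and> (\<forall>b\<in>B. bounded_linear (r b)) \<and> (\<forall>x. (\<Sum>b\<in>B. r b x *\<^sub>R b) = x)"
proof -
  obtain B0 :: "'e set" where B0: "finite B0" "span B0 = UNIV" using assms by blast
  obtain B where B: "B \<subseteq> B0" "independent B" "B0 \<subseteq> span B"
    using maximal_independent_subset[of B0] by blast
  have fin: "finite B" using B(1) B0(1) finite_subset by blast
  have sp: "span B = UNIV" using B(3) B0(2) by (metis span_mono span_span top.extremum_unique)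
  define r where "r = (\<lambda>b x. representation B x b)"
  have eq: "(\<Sum>b\<in>B. r b x *\<^sub>R b) = x" for x
    using sum_representation_eq[OF B(2), of x B] sp fin by (simp add: r_def)
  obtain C where C: "\<And>c b. b \<in> B \<Longrightarrow> \<bar>c b\<bar> \<le> C * norm (\<Sum>b\<in>B. c b *\<^sub>R b)"
    using coordinates_bounded[OF fin B(2)] by blast
  have "bounded_linear (r b)" if b: "b \<in> B" for b
  proof (rule bounded_linear_intro)
    show "r b (x + y) = r b x + r b y" for x y
      using representation_add[OF B(2), of y x] sp unfolding r_def by auto
    show "r b (k *\<^sub>R x) = k *\<^sub>R r b x" for k x
      using representation_scale[OF B(2), of x k] sp unfolding r_def by auto
    show "norm (r b x) \<le> norm x * C" for x
      using C[OF b, of "\<lambda>b. r b x"] by (simp add: eq mult.commute)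
  qed
  then show ?thesis using fin eq by blast
qed

text \<open>
  Makes functionals on the Lie algebra, which are only assumed linear, commute with derivatives.
\<close>

lemma finite_dim_bounded_linear:
  fixes f :: "'e::banach \<Rightarrow> 'b::real_normed_vector"
  assumes "\<exists>B::'e set. finite B \<and> span B = UNIV" and "linear f"
  shows "bounded_linear f"
proof -
  obtain B :: "'e set" and r :: "'e \<Rightarrow> 'e \<Rightarrow> real" where B: "finite B" "\<And>b. b \<in> B \<Longrightarrow> bounded_linear (r b)"
    "\<And>x. (\<Sum>b\<in>B. r b x *\<^sub>R b) = x"
    using finite_dim_coordinates[OF assms(1)] by blast
  have "f x = (\<Sum>b\<in>B. r b x *\<^sub>R f b)" for x
    by (subst (1) B(3)[of x, symmetric]) (simp add: linear_sum[OF assms(2)] linear_scale[OF assms(2)])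
  then have "f = (\<lambda>x. \<Sum>b\<in>B. r b x *\<^sub>R f b)" by blast
  then show ?thesis
    by (rule ssubst) (intro bounded_linear_sum bounded_linear_scaleR_const B(2))
qed

text \<open>
  A product rule for \<open>A p (u p)\<close> that needs no topology on the space of linear maps: expand
  \<open>u p\<close> in coordinates.
\<close>

lemma differentiable_linear_family:
  fixes A :: "'a::real_normed_vector \<Rightarrow> 'e::banach \<Rightarrow> 'b::real_normed_vector"
  assumes fd: "\<exists>B::'e set. finite B \<and> span B = UNIV"
    and lin: "\<forall>\<^sub>F p in nhds p0. linear (A p)"
    and A: "\<And>b. (\<lambda>p. A p b) differentiable (at p0)"
    and u: "u differentiable (at p0)"
  shows "(\<lambda>p. A p (u p)) differentiable (at p0)"
proof -
  obtain B :: "'e set" and r :: "'e \<Rightarrow> 'e \<Rightarrow> real" where B: "finite B" "\<And>b. b \<in> B \<Longrightarrow> bounded_linear (r b)"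
    "\<And>x. (\<Sum>b\<in>B. r b x *\<^sub>R b) = x"
    using finite_dim_coordinates[OF fd] by blast
  have *: "A p (u p) = (\<Sum>b\<in>B. r b (u p) *\<^sub>R A p b)" if "linear (A p)" for p
    by (subst (1) B(3)[of "u p", symmetric]) (simp add: linear_sum[OF that] linear_scale[OF that])
  have "(\<lambda>p. r b (u p)) differentiable (at p0)" if "b \<in> B" for b
    using differentiable_compose[of "r b" u p0 UNIV] u B(2)[OF that]
    by (simp add: bounded_linear_imp_differentiable)
  then have "(\<lambda>p. \<Sum>b\<in>B. r b (u p) *\<^sub>R A p b) differentiable (at p0)"
    using A by (intro differentiable_sum B(1) ballI differentiable_scaleR) auto
  moreover have "\<forall>\<^sub>F p in nhds p0. A p (u p) = (\<Sum>b\<in>B. r b (u p) *\<^sub>R A p b)"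
    using lin by eventually_elim (rule *)
  ultimately show ?thesis
    by (intro differentiable_cong_nhds[of "\<lambda>p. A p (u p)"])
qed

text \<open>
  Continuity of \<open>p \<mapsto> D p w\<close> for every fixed \<open>w\<close> bounds \<open>D p\<close> on the finitely many vectors of a
  basis near \<open>p0\<close>, and therefore in operator norm.
\<close>

lemma C1_locally_lipschitz:
  fixes F :: "'e::banach \<Rightarrow> 'b::real_normed_vector"
  assumes fd: "\<exists>B::'e set. finite B \<and> span B = UNIV"
    and U: "open U" "p0 \<in> U" and F: "\<And>p. p \<in> U \<Longrightarrow> (F has_derivative D p) (at p)"
    and D: "\<And>w. continuous_on U (\<lambda>p. D p w)"
  shows "\<exists>r>0. \<exists>L\<ge>0. cball p0 r \<subseteq> U \<and>
    (\<forall>x\<in>cball p0 r. \<forall>y\<in>cball p0 r. norm (F x - F y) \<le> L * norm (x - y))"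
proof -
  obtain B :: "'e set" and k :: "'e \<Rightarrow> 'e \<Rightarrow> real"
    where B: "finite B" "\<And>b. b \<in> B \<Longrightarrow> bounded_linear (k b)" "\<And>x. (\<Sum>b\<in>B. k b x *\<^sub>R b) = x"
    using finite_dim_coordinates[OF fd] by blast
  have "\<forall>\<^sub>F p in nhds p0. norm (D p b) \<le> norm (D p0 b) + 1" for b
  proof -
    have "isCont (\<lambda>p. norm (D p b)) p0"
      using D[of b] U by (intro continuous_norm) (simp add: continuous_on_eq_continuous_at)
    then have "((\<lambda>p. norm (D p b)) \<longlongrightarrow> norm (D p0 b)) (nhds p0)"
      unfolding continuous_within using tendsto_at_iff_tendsto_nhds by blast
    then have "\<forall>\<^sub>F p in nhds p0. norm (D p b) < norm (D p0 b) + 1"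
      by (rule order_tendstoD) simp
    then show ?thesis by eventually_elim simp
  qed
  then have "\<forall>\<^sub>F p in nhds p0. \<forall>b\<in>B. norm (D p b) \<le> norm (D p0 b) + 1"
    using B(1) by (simp add: eventually_ball_finite)
  moreover have "\<forall>\<^sub>F p in nhds p0. p \<in> U" using U by (rule eventually_nhds_in_open)
  ultimately have "\<forall>\<^sub>F p in nhds p0. p \<in> U \<and> (\<forall>b\<in>B. norm (D p b) \<le> norm (D p0 b) + 1)"
    by (simp add: eventually_conj_iff)
  then obtain e where e: "e > 0" "\<And>p. dist p p0 < e \<Longrightarrow> p \<in> U \<and> (\<forall>b\<in>B. norm (D p b) \<le> norm (D p0 b) + 1)"
    unfolding eventually_nhds_metric by blast
  define L where "L = (\<Sum>b\<in>B. onorm (k b) * (norm (D p0 b) + 1))"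
  have L0: "L \<ge> 0" unfolding L_def
    by (intro sum_nonneg mult_nonneg_nonneg onorm_pos_le B(2)) auto
  have ball: "p \<in> U" "\<And>b. b \<in> B \<Longrightarrow> norm (D p b) \<le> norm (D p0 b) + 1" if "p \<in> cball p0 (e/2)" for p
    using e(2)[of p] that e(1) by (auto simp: dist_commute)
  have bound: "onorm (D p) \<le> L" if p: "p \<in> cball p0 (e/2)" for p
  proof (rule onorm_bound[OF L0])
    fix x
    have lin: "linear (D p)" using F[OF ball(1)[OF p]] has_derivative_linear by blast
    have "D p x = D p (\<Sum>b\<in>B. k b x *\<^sub>R b)" using B(3)[of x] by simp
    also have "\<dots> = (\<Sum>b\<in>B. k b x *\<^sub>R D p b)" by (simp add: linear_sum[OF lin] linear_scale[OF lin])
    finally have "norm (D p x) \<le> (\<Sum>b\<in>B. norm (k b x *\<^sub>R D p b))" by (simp only: norm_sum)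
    also have "\<dots> \<le> (\<Sum>b\<in>B. (onorm (k b) * norm x) * (norm (D p0 b) + 1))"
    proof (rule sum_mono)
      fix b assume b: "b \<in> B"
      have "\<bar>k b x\<bar> * norm (D p b) \<le> (onorm (k b) * norm x) * (norm (D p0 b) + 1)"
        using onorm[OF B(2)[OF b], of x] onorm_pos_le[OF B(2)[OF b]]
        by (intro mult_mono ball(2)[OF p b]) auto
      then show "norm (k b x *\<^sub>R D p b) \<le> (onorm (k b) * norm x) * (norm (D p0 b) + 1)" by simp
    qed
    also have "\<dots> = L * norm x" unfolding L_def sum_distrib_right by (intro sum.cong) (auto simp: mult_ac)
    finally show "norm (D p x) \<le> L * norm x" .
  qed
  have "norm (F x - F y) \<le> L * norm (x - y)" if "x \<in> cball p0 (e/2)" "y \<in> cball p0 (e/2)" for x y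
    using differentiable_bound[of "cball p0 (e/2)" F D L x y] that bound F[OF ball(1)]
    by (auto intro: has_derivative_at_withinI)
  moreover have "cball p0 (e/2) \<subseteq> U" using ball(1) by blast
  ultimately show ?thesis using e(1) L0 by (intro exI[of _ "e/2"] conjI exI[of _ L]) auto
qed

section \<open>Autonomous differential equations\<close>

text \<open>
  Picard iteration. Curves are bounded continuous functions on the whole line, made
  constant outside \<open>[-a, a]\<close> by the clamping function \<open>cl\<close>; this gives a complete metric space for the fixed-point
  theorem.
\<close>

lemma autonomous_ODE_exists:
  fixes F :: "'e::banach \<Rightarrow> 'e"
  assumes r: "r > 0" and L: "L \<ge> 0"
    and lip: "\<And>x y. x \<in> cball p0 r \<Longrightarrow> y \<in> cball p0 r \<Longrightarrow> norm (F x - F y) \<le> L * norm (x - y)"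
  shows "\<exists>a>0. \<exists>y. y 0 = p0 \<and> (\<forall>t\<in>{-a..a}. y t \<in> cball p0 r) \<and>
           (\<forall>t\<in>{-a<..<a}. (y has_vector_derivative F (y t)) (at t))"
proof -
  define K where "K = norm (F p0) + L * r"
  have K0: "K \<ge> 0" using r L by (simp add: K_def)
  have FK: "norm (F x) \<le> K" if "x \<in> cball p0 r" for x
  proof -
    have "norm (F x) \<le> norm (F p0) + norm (F x - F p0)" by (metis add.commute norm_triangle_sub)
    also have "norm (F x - F p0) \<le> L * norm (x - p0)" using lip[OF that, of p0] r by simp
    also have "\<dots> \<le> L * r" using that L by (intro mult_left_mono) (auto simp: dist_norm norm_minus_commute)
    finally show ?thesis by (simp add: K_def)
  qed
  have contF: "continuous_on (cball p0 r) F"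
    by (rule lipschitz_on_continuous_on[of L], rule lipschitz_onI) (use lip L in \<open>auto simp: dist_norm\<close>)
  \<comment> \<open>the first bound keeps the iterates in the ball, the second makes the iteration a contraction\<close>
  define a where "a = min (r / (K + 1)) (1 / (2 * (L + 1)))"
  have a0: "a > 0" using r L K0 by (simp add: a_def)
  have aK: "a * K \<le> r"
  proof -
    have "a * K \<le> (r / (K + 1)) * K" using K0 by (intro mult_right_mono) (auto simp: a_def)
    also have "\<dots> \<le> r" using K0 r by (simp add: field_simps)
    finally show ?thesis .
  qed
  have aL: "L * a \<le> 1/2"
  proof -
    have "L * a \<le> L * (1 / (2 * (L + 1)))" using L by (intro mult_left_mono) (auto simp: a_def)
    also have "\<dots> \<le> 1/2" using L by (simp add: field_simps)
    finally show ?thesis .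
  qed
  define cl where "cl t = max (-a) (min a t)" for t :: real
  have cl: "cl t \<in> {-a..a}" for t using a0 by (auto simp: cl_def)
  have cl_id: "cl t = t" if "t \<in> {-a..a}" for t using that by (auto simp: cl_def)
  have cont_cl: "continuous_on UNIV cl" unfolding cl_def by (intro continuous_intros)
  define S where "S = (PiC UNIV (\<lambda>_. cball p0 r) :: (real \<Rightarrow>\<^sub>C 'e) set)"
  have inS: "apply_bcontfun f t \<in> cball p0 r" if "f \<in> S" for f t
    using that by (auto simp: S_def mem_PiC_iff Pi_iff)
  define I where "I f s = integral {-a..s} (\<lambda>t. F (apply_bcontfun f t)) - integral {-a..0} (\<lambda>t. F (apply_bcontfun f t))"
    for f :: "real \<Rightarrow>\<^sub>C 'e" and s
  have Ider: "((\<lambda>s. I f s) has_vector_derivative F (apply_bcontfun f s)) (at s within {-a..a})"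
    if "f \<in> S" "s \<in> {-a..a}" for f s
  proof -
    have "continuous_on {-a..a} (\<lambda>t. F (apply_bcontfun f t))"
      by (rule continuous_on_compose2[OF contF]) (use inS[OF that(1)] in auto)
    from integral_has_vector_derivative[OF this that(2)]
    show ?thesis unfolding I_def by (auto intro!: derivative_eq_intros)
  qed
  have Ibound: "norm (I f s) \<le> r" if "f \<in> S" "s \<in> {-a..a}" for f s
  proof -
    have "norm (I f s - I f 0) \<le> K * \<bar>s - 0\<bar>"
      by (rule vector_derivative_bound[where S="{-a..a}" and g'="\<lambda>s. F (apply_bcontfun f s)"])
        (use Ider[OF that(1)] FK inS[OF that(1)] that a0 in auto)
    also have "\<dots> \<le> K * a" using that K0 by (intro mult_left_mono) auto
    finally show ?thesis using aK by (simp add: I_def mult.commute)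
  qed
  have Icont: "continuous_on {-a..a} (I f)" if "f \<in> S" for f
    using Ider[OF that] has_vector_derivative_continuous continuous_on_eq_continuous_within by blast
  define T where "T f = Bcontfun (\<lambda>t. p0 + I f (cl t))" for f
  have T: "apply_bcontfun (T f) t = p0 + I f (cl t)" if "f \<in> S" for f t
  proof -
    have "continuous_on UNIV (\<lambda>t. I f (cl t))"
      by (rule continuous_on_compose2[OF Icont[OF that] cont_cl]) (use cl in auto)
    then have "(\<lambda>t. p0 + I f (cl t)) \<in> bcontfun"
      unfolding bcontfun_def bounded_iff
      using Ibound[OF that cl]
      by (auto intro!: continuous_intros exI[of _ "norm p0 + r"] intro: order_trans[OF norm_triangle_ineq])
    then show ?thesis by (simp add: T_def Bcontfun_inverse)
  qed
  have TS: "T ` S \<subseteq> S"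
  proof safe
    fix f assume f: "f \<in> S"
    have "apply_bcontfun (T f) t \<in> cball p0 r" for t
      using T[OF f] Ibound[OF f cl] by (simp add: dist_norm)
    then show "T f \<in> S" by (simp add: S_def mem_PiC_iff Pi_iff)
  qed
  have contr: "dist (T f) (T g) \<le> 1/2 * dist f g" if "f \<in> S" "g \<in> S" for f g
  proof (rule dist_bound)
    fix t
    have "norm ((I f (cl t) - I g (cl t)) - (I f 0 - I g 0)) \<le> (L * dist f g) * \<bar>cl t - 0\<bar>"
    proof (rule vector_derivative_bound[where S="{-a..a}" and
        g'="\<lambda>s. F (apply_bcontfun f s) - F (apply_bcontfun g s)"])
      fix s assume s: "s \<in> {-a..a}"
      show "((\<lambda>s. I f s - I g s) has_vector_derivative F (apply_bcontfun f s) - F (apply_bcontfun g s)) (at s within {-a..a})"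
        by (intro derivative_intros Ider that s)
      have "norm (F (apply_bcontfun f s) - F (apply_bcontfun g s)) \<le> L * norm (apply_bcontfun f s - apply_bcontfun g s)"
        using lip inS that by blast
      also have "\<dots> \<le> L * dist f g"
        using dist_bounded[of f s g] L by (intro mult_left_mono) (auto simp: dist_norm)
      finally show "norm (F (apply_bcontfun f s) - F (apply_bcontfun g s)) \<le> L * dist f g" .
    qed (use cl a0 in auto)
    also have "\<dots> \<le> (L * dist f g) * a" using cl[of t] L by (intro mult_left_mono) auto
    also have "\<dots> = (L * a) * dist f g" by simp
    also have "\<dots> \<le> 1/2 * dist f g" using aL by (intro mult_right_mono) auto
    finally show "dist (apply_bcontfun (T f) t) (apply_bcontfun (T g) t) \<le> 1/2 * dist f g"
      by (simp add: T that dist_norm I_def)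
  qed
  have "closed S" unfolding S_def by (rule closed_PiC) auto
  then have "complete S" by (simp add: complete_eq_closed)
  moreover have "const_bcontfun p0 \<in> S"
    using r by (simp add: S_def mem_PiC_iff Pi_iff const_bcontfun.rep_eq)
  then have "S \<noteq> {}" by blast
  ultimately have "\<exists>!f\<in>S. T f = f"
    by (rule Banach_fix[where c="1/2"]) (use TS contr in auto)
  then obtain f where f: "f \<in> S" "T f = f" by blast
  define y where "y = apply_bcontfun f"
  have y: "y t = p0 + I f t" if "t \<in> {-a..a}" for t
    using T[OF f(1), of t] f(2) cl_id[OF that] by (simp add: y_def)
  have "(y has_vector_derivative F (y t)) (at t)" if t: "t \<in> {-a<..<a}" for t
  proof -
    have "(I f has_vector_derivative F (y t)) (at t within {-a..a})"
      using Ider[OF f(1), of t] t by (simp add: y_def)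
    then have "(I f has_vector_derivative F (y t)) (at t)"
      using t by (simp add: at_within_Icc_at)
    then have "((\<lambda>t. p0 + I f t) has_vector_derivative F (y t)) (at t)"
      by (auto intro!: derivative_eq_intros)
    then show ?thesis
      by (rule has_vector_derivative_transform_within_open[where S="{-a<..<a}"]) (use t y in auto)
  qed
  moreover have "y 0 = p0" using y[of 0] a0 by (simp add: I_def)
  moreover have "y t \<in> cball p0 r" for t using inS[OF f(1)] by (simp add: y_def)
  ultimately show ?thesis using a0 by blast
qed

text \<open>
  The maximal distance \<open>D\<close> of two solutions satisfies \<open>D \<le> L a D\<close> by the mean value inequality.
\<close>

lemma autonomous_ODE_unique:
  fixes F :: "'e::real_normed_vector \<Rightarrow> 'e"
  assumes lip: "\<And>x y. x \<in> S \<Longrightarrow> y \<in> S \<Longrightarrow> norm (F x - F y) \<le> L * norm (x - y)"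
    and L: "L \<ge> 0" and a: "L * a < 1"
    and y: "\<And>t. \<bar>t\<bar> \<le> a \<Longrightarrow> y t \<in> S \<and> (y has_vector_derivative F (y t)) (at t)"
    and z: "\<And>t. \<bar>t\<bar> \<le> a \<Longrightarrow> z t \<in> S \<and> (z has_vector_derivative F (z t)) (at t)"
    and init: "y 0 = z 0" and t: "\<bar>t\<bar> \<le> a"
  shows "y t = z t"
proof -
  have a0: "a \<ge> 0" using t by linarith
  have der: "((\<lambda>t. y t - z t) has_vector_derivative F (y t) - F (z t)) (at t within {-a..a})"
    if "t \<in> {-a..a}" for t
    using y[of t] z[of t] that
    by (intro derivative_intros) (auto intro: has_vector_derivative_at_within)
  then have "continuous_on {-a..a} (\<lambda>t. norm (y t - z t))"
    by (intro continuous_on_norm)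
      (meson has_vector_derivative_continuous continuous_on_eq_continuous_within)
  then obtain m where m: "m \<in> {-a..a}" "\<And>t. t \<in> {-a..a} \<Longrightarrow> norm (y t - z t) \<le> norm (y m - z m)"
    using continuous_attains_sup[of "{-a..a}" "\<lambda>t. norm (y t - z t)"] a0 by auto
  define D where "D = norm (y m - z m)"
  have "norm ((y m - z m) - (y 0 - z 0)) \<le> (L * D) * \<bar>m - 0\<bar>"
  proof (rule vector_derivative_bound[where S="{-a..a}" and g'="\<lambda>t. F (y t) - F (z t)"])
    fix t assume t: "t \<in> {-a..a}"
    have "norm (F (y t) - F (z t)) \<le> L * norm (y t - z t)"
      using lip y z t by (meson abs_le_iff atLeastAtMost_iff minus_le_iff)
    also have "\<dots> \<le> L * D" using m(2)[OF t] L by (simp add: D_def mult_left_mono)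
    finally show "norm (F (y t) - F (z t)) \<le> L * D" .
  qed (use der m a0 in auto)
  also have "\<dots> \<le> (L * D) * a" using m(1) L by (intro mult_left_mono) (auto simp: D_def)
  finally have "D \<le> (L * a) * D" using init by (simp add: D_def mult_ac)
  then have "D \<le> 0"
    using a by (metis D_def mult_less_cancel_right2 norm_ge_zero not_less order_le_less)
  then show ?thesis using m(2)[of t] t by (auto simp: D_def abs_le_iff)
qed

section \<open>Charts, tangent vectors and curves\<close>

lemma charts_at_iff: "c \<in> charts_at M x \<longleftrightarrow> c \<in> atlas M \<and> x \<in> fst c"
  by (simp add: charts_at_def)

lemma charts_at_nonempty:
  assumes "smooth_manifold M" "x \<in> points M"
  obtains c where "c \<in> charts_at M x"
proof -
  have "x \<in> (\<Union>c \<in> atlas M. fst c)" using assms by (simp add: smooth_manifold_def)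
  then show ?thesis using that by (auto simp: charts_at_iff)
qed

lemma chart_facts:
  assumes "smooth_manifold M" "c \<in> atlas M"
  shows chart_domain_open: "openin (mtop M) (fst c)"
    and chart_image_open: "open (snd c ` fst c)"
    and chart_homeo: "homeomorphic_map (subtopology (mtop M) (fst c)) (top_of_set (snd c ` fst c)) (snd c)"
    and chart_domain_subset: "fst c \<subseteq> points M"
    and chart_inj: "inj_on (snd c) (fst c)"
proof -
  show 1: "openin (mtop M) (fst c)" and "open (snd c ` fst c)"
    and 2: "homeomorphic_map (subtopology (mtop M) (fst c)) (top_of_set (snd c ` fst c)) (snd c)"
    using assms by (auto simp: smooth_manifold_def)
  show 3: "fst c \<subseteq> points M" using 1 by (rule openin_subset)
  show "inj_on (snd c) (fst c)"
    using homeomorphic_imp_injective_map[OF 2] 3 by (simp add: topspace_subtopology Int_absorb1)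
qed

lemma chart_inv_left [simp]:
  assumes "smooth_manifold M" "c \<in> atlas M" "x \<in> fst c"
  shows "chart_inv c (snd c x) = x"
  using chart_inj[OF assms(1,2)] assms(3) by (simp add: chart_inv_def)

lemma chart_inv_right: "p \<in> snd c ` fst c \<Longrightarrow> snd c (chart_inv c p) = p"
  by (simp add: chart_inv_def f_inv_into_f)

lemma chart_inv_in: "p \<in> snd c ` fst c \<Longrightarrow> chart_inv c p \<in> fst c"
  by (simp add: chart_inv_def inv_into_into)

lemma chart_eventually:
  assumes M: "smooth_manifold M" and c: "c \<in> atlas M" "x \<in> fst c"
    and V: "openin (mtop M) V" "x \<in> V"
  shows "\<forall>\<^sub>F p in nhds (snd c x). p \<in> snd c ` fst c \<and> chart_inv c p \<in> V"
proof -
  have "openin (subtopology (mtop M) (fst c)) (V \<inter> fst c)"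
    using V by (auto simp: openin_subtopology)
  then have "openin (top_of_set (snd c ` fst c)) (snd c ` (V \<inter> fst c))"
    using homeomorphic_imp_open_map[OF chart_homeo[OF M c(1)]] by (simp add: open_map_def)
  then have "open (snd c ` (V \<inter> fst c))"
    using chart_image_open[OF M c(1)] openin_open_eq by blast
  moreover have "snd c x \<in> snd c ` (V \<inter> fst c)" using V c by blast
  ultimately have "\<forall>\<^sub>F p in nhds (snd c x). p \<in> snd c ` (V \<inter> fst c)"
    by (rule eventually_nhds_in_open)
  then show ?thesis
    by eventually_elim (use chart_inv_left[OF M c(1)] in auto)
qed

text \<open>
  Turns continuity of a map into a statement about the coordinates near \<open>snd c x\<close>, where all derivatives
  live.
\<close>

lemma chart_eventually':
  assumes M: "smooth_manifold M" and N: "continuous_map (mtop M) X f"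
    and c: "c \<in> atlas M" "x \<in> fst c" and V: "openin X V" "f x \<in> V"
  shows "\<forall>\<^sub>F p in nhds (snd c x). p \<in> snd c ` fst c \<and> f (chart_inv c p) \<in> V"
proof -
  have "openin (mtop M) {y \<in> points M. f y \<in> V}"
    using N V(1) by (rule openin_continuous_map_preimage)
  moreover have "x \<in> points M" using chart_domain_subset[OF M c(1)] c(2) by blast
  ultimately show ?thesis
    using chart_eventually[OF M c, of "{y \<in> points M. f y \<in> V}"] V(2)
    by (simp add: eventually_conj_iff)
qed

lemma curve_eventually:
  assumes "continuous_map euclideanreal X \<gamma>" "openin X V" "\<gamma> t \<in> V"
  shows "\<forall>\<^sub>F s in nhds t. \<gamma> s \<in> V"
proof -
  have "open {s. \<gamma> s \<in> V}"
    using openin_continuous_map_preimage[OF assms(1,2)] by simp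
  from eventually_nhds_in_open[OF this, of t] show ?thesis using assms(3) by simp
qed

lemma chart_continuous_at:
  assumes M: "smooth_manifold M" and c: "c \<in> atlas M" "x \<in> fst c"
    and V: "open V" "snd c x \<in> V"
  obtains N where "openin (mtop M) N" "x \<in> N" "N \<subseteq> fst c" "\<And>y. y \<in> N \<Longrightarrow> snd c y \<in> V"
proof -
  have cm: "continuous_map (subtopology (mtop M) (fst c)) (top_of_set (snd c ` fst c)) (snd c)"
    using chart_homeo[OF M c(1)] by (rule homeomorphic_imp_continuous_map)
  have "openin (top_of_set (snd c ` fst c)) (V \<inter> snd c ` fst c)"
    using V(1) by (metis Int_commute openin_open_Int)
  from openin_continuous_map_preimage[OF cm this]
  have "openin (subtopology (mtop M) (fst c)) {y \<in> fst c. snd c y \<in> V}"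
    using chart_domain_subset[OF M c(1)]
    by (auto simp: Int_absorb1 elim!: back_subst[of "openin _"])
  then have "openin (mtop M) {y \<in> fst c. snd c y \<in> V}"
    using chart_domain_open[OF M c(1)] openin_trans_full by blast
  then show ?thesis
    by (rule that) (use c V in auto)
qed

lemma smooth_on_differentiable:
  assumes "smooth_on S f" "x \<in> S"
  shows "f differentiable (at x)"
  using assms unfolding smooth_on_def by (metis Ck_on.simps(2))

lemma transition_differentiable:
  assumes "smooth_manifold M" "c \<in> charts_at M x" "d \<in> charts_at M x"
  shows "(snd d \<circ> chart_inv c) differentiable (at (snd c x))"
proof (rule smooth_on_differentiable)
  show "smooth_on (snd c ` (fst c \<inter> fst d)) (snd d \<circ> chart_inv c)"
    using assms unfolding smooth_manifold_def charts_at_iff by blast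
  show "snd c x \<in> snd c ` (fst c \<inter> fst d)" using assms by (simp add: charts_at_iff)
qed

lemma tangent_space_zero: "w \<in> tangent_space M x \<Longrightarrow> c \<notin> charts_at M x \<Longrightarrow> w c = 0"
  unfolding tangent_space_def by blast

lemma tangent_space_transition:
  "w \<in> tangent_space M x \<Longrightarrow> c \<in> charts_at M x \<Longrightarrow> d \<in> charts_at M x \<Longrightarrow>
    w d = frechet_derivative (snd d \<circ> chart_inv c) (at (snd c x)) (w c)"
  unfolding tangent_space_def by blast

lemma change_chart:
  assumes M: "smooth_manifold M" and c: "c \<in> charts_at M x" and d: "d \<in> charts_at M x"
  shows "\<forall>\<^sub>F p in nhds (snd d x). (F \<circ> chart_inv d) p = (F \<circ> chart_inv c) ((snd c \<circ> chart_inv d) p)"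
proof -
  have c': "c \<in> atlas M" "x \<in> fst c" and d': "d \<in> atlas M" "x \<in> fst d"
    using c d by (simp_all add: charts_at_iff)
  from chart_eventually[OF M d' chart_domain_open[OF M c'(1)] c'(2)]
  show ?thesis by eventually_elim (simp add: chart_inv_left[OF M c'(1)])
qed

text \<open>
  The chain rule through a transition map: the differential of a function does not depend on the
  chart. With a coordinate map in place of \<open>F\<close> it also yields the cocycle rule for transition maps.
\<close>

lemma change_chart_derivative:
  assumes M: "smooth_manifold M" and c: "c \<in> charts_at M x" and d: "d \<in> charts_at M x"
    and F: "(F \<circ> chart_inv c) differentiable (at (snd c x))"
  shows "((F \<circ> chart_inv d) has_derivative
     (\<lambda>u. frechet_derivative (F \<circ> chart_inv c) (at (snd c x))
        (frechet_derivative (snd c \<circ> chart_inv d) (at (snd d x)) u))) (at (snd d x))"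
proof (rule has_derivative_cong_nhds[OF change_chart[OF M c d]])
  have eq: "(snd c \<circ> chart_inv d) (snd d x) = snd c x"
    using d chart_inv_left[OF M] by (simp add: charts_at_iff)
  have "((snd c \<circ> chart_inv d) has_derivative frechet_derivative (snd c \<circ> chart_inv d) (at (snd d x))) (at (snd d x))"
    using transition_differentiable[OF M d c] frechet_derivative_works by blast
  moreover have "((F \<circ> chart_inv c) has_derivative frechet_derivative (F \<circ> chart_inv c) (at (snd c x)))
      (at ((snd c \<circ> chart_inv d) (snd d x)))"
    using F frechet_derivative_works unfolding eq by blast
  ultimately show "((\<lambda>p. (F \<circ> chart_inv c) ((snd c \<circ> chart_inv d) p)) has_derivative
     (\<lambda>u. frechet_derivative (F \<circ> chart_inv c) (at (snd c x))
        (frechet_derivative (snd c \<circ> chart_inv d) (at (snd d x)) u))) (at (snd d x))"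
    by (rule has_derivative_compose)
qed

lemma diff_fun_chart:
  assumes M: "smooth_manifold M" and c: "c \<in> charts_at M x" and v: "v \<in> tangent_space M x"
    and F: "(F \<circ> chart_inv c) differentiable (at (snd c x))"
  shows "diff_fun M F x v = frechet_derivative (F \<circ> chart_inv c) (at (snd c x)) (v c)"
proof -
  define d where "d = (SOME c. c \<in> charts_at M x)"
  have d: "d \<in> charts_at M x" unfolding d_def using c by (rule someI)
  have "v c = frechet_derivative (snd c \<circ> chart_inv d) (at (snd d x)) (v d)"
    by (rule tangent_space_transition[OF v d c])
  then show ?thesis
    using frechet_derivative_at[OF change_chart_derivative[OF M c d F]]
    by (simp add: diff_fun_def Let_def d_def[symmetric] fun_eq_iff)
qed

lemma curve_in_chart:
  assumes M: "smooth_manifold M" and c: "c \<in> charts_at M (\<gamma> t)"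
    and \<gamma>: "continuous_map euclideanreal (mtop M) \<gamma>"
  shows "\<forall>\<^sub>F s in nhds t. F (\<gamma> s) = (F \<circ> chart_inv c) ((snd c \<circ> \<gamma>) s)"
proof -
  have c': "c \<in> atlas M" "\<gamma> t \<in> fst c" using c by (simp_all add: charts_at_iff)
  from curve_eventually[OF \<gamma> chart_domain_open[OF M c'(1)] c'(2)]
  show ?thesis by eventually_elim (simp add: chart_inv_left[OF M c'(1)])
qed

lemma curve_chart_derivative:
  assumes M: "smooth_manifold M" and c: "c \<in> charts_at M (\<gamma> t)"
    and \<gamma>: "continuous_map euclideanreal (mtop M) \<gamma>"
    and v: "((snd c \<circ> \<gamma>) has_vector_derivative v) (at t)"
    and F: "(F \<circ> chart_inv c) differentiable (at (snd c (\<gamma> t)))"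
  shows "((\<lambda>s. F (\<gamma> s)) has_vector_derivative frechet_derivative (F \<circ> chart_inv c) (at (snd c (\<gamma> t))) v) (at t)"
proof (rule has_vector_derivative_cong_nhds[OF curve_in_chart[OF M c \<gamma>]])
  have "((F \<circ> chart_inv c) has_derivative frechet_derivative (F \<circ> chart_inv c) (at (snd c (\<gamma> t))))
      (at ((snd c \<circ> \<gamma>) t))"
    using F by (simp only: o_apply frechet_derivative_works)
  from vector_derivative_chain[OF v this]
  show "((\<lambda>s. (F \<circ> chart_inv c) ((snd c \<circ> \<gamma>) s)) has_vector_derivative
      frechet_derivative (F \<circ> chart_inv c) (at (snd c (\<gamma> t))) v) (at t)" .
qed

lemma diff_fun_curve:
  assumes M: "smooth_manifold M" and c: "c \<in> charts_at M (\<gamma> t)"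
    and \<gamma>: "continuous_map euclideanreal (mtop M) \<gamma>" and v: "has_velocity M \<gamma> t v"
    and F: "(F \<circ> chart_inv c) differentiable (at (snd c (\<gamma> t)))"
  shows "((\<lambda>s. F (\<gamma> s)) has_vector_derivative diff_fun M F (\<gamma> t) v) (at t)"
proof -
  have "((snd c \<circ> \<gamma>) has_vector_derivative v c) (at t)" and T: "v \<in> tangent_space M (\<gamma> t)"
    using v c unfolding has_velocity_def by blast+
  from curve_chart_derivative[OF M c \<gamma> this(1) F] show ?thesis
    unfolding diff_fun_chart[OF M c T F] .
qed

text \<open>
  The compatibility of the components with the transition maps is automatic for the derivatives of a
  continuous curve. Continuity in \<open>M\<close> matters, because the derivative of \<open>snd d \<circ> \<gamma>\<close> also sees the values of
  \<open>snd d\<close> outside its domain.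
\<close>

lemma has_velocityI:
  assumes M: "smooth_manifold M" and \<gamma>: "continuous_map euclideanreal (mtop M) \<gamma>"
    and w: "\<And>d. d \<in> charts_at M (\<gamma> t) \<Longrightarrow> ((snd d \<circ> \<gamma>) has_vector_derivative w d) (at t)"
    and w0: "\<And>d. d \<notin> charts_at M (\<gamma> t) \<Longrightarrow> w d = 0"
  shows "has_velocity M \<gamma> t w"
proof -
  have "w d = frechet_derivative (snd d \<circ> chart_inv c) (at (snd c (\<gamma> t))) (w c)"
    if c: "c \<in> charts_at M (\<gamma> t)" and d: "d \<in> charts_at M (\<gamma> t)" for c d
    using curve_chart_derivative[OF M c \<gamma> w[OF c] transition_differentiable[OF M c d]] w[OF d]
    by (auto simp: o_def intro: vector_derivative_unique_at)
  then show ?thesis unfolding has_velocity_def tangent_space_def using w w0 by blast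
qed

lemma has_velocity_zero:
  "has_velocity M \<gamma> t v \<Longrightarrow> d \<notin> charts_at M (\<gamma> t) \<Longrightarrow> v d = 0"
  unfolding has_velocity_def tangent_space_def by blast

lemma has_velocity_component:
  "has_velocity M \<gamma> t v \<Longrightarrow> d \<in> charts_at M (\<gamma> t) \<Longrightarrow>
    ((snd d \<circ> \<gamma>) has_vector_derivative v d) (at t)"
  unfolding has_velocity_def by blast

lemma has_velocity_tangent: "has_velocity M \<gamma> t v \<Longrightarrow> v \<in> tangent_space M (\<gamma> t)"
  unfolding has_velocity_def by blast

lemma has_velocity_unique:
  assumes v: "has_velocity M \<gamma> t v" and w: "has_velocity M \<gamma> t w"
  shows "v = w"
proof
  fix d
  show "v d = w d"
  proof (cases "d \<in> charts_at M (\<gamma> t)")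
    case True
    then show ?thesis
      using has_velocity_component[OF v] has_velocity_component[OF w] vector_derivative_unique_at by blast
  next
    case False
    then show ?thesis using has_velocity_zero[OF v] has_velocity_zero[OF w] by metis
  qed
qed

lemma velocity_eq:
  assumes v: "has_velocity M \<gamma> t v"
  shows "velocity M \<gamma> t = v"
proof
  fix d
  show "velocity M \<gamma> t d = v d"
  proof (cases "d \<in> charts_at M (\<gamma> t)")
    case True
    then show ?thesis
      using vector_derivative_at[OF has_velocity_component[OF v]] by (simp add: velocity_def)
  next
    case False
    then show ?thesis using has_velocity_zero[OF v] by (simp add: velocity_def)
  qed
qed

lemma has_velocity_scale:
  assumes M: "smooth_manifold M" and \<gamma>: "continuous_map euclideanreal (mtop M) \<gamma>"
    and v: "has_velocity M \<gamma> (r * t) v"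
  shows "has_velocity M (\<lambda>s. \<gamma> (r * s)) t (r *\<^sub>R v)"
proof (rule has_velocityI[OF M])
  have "continuous_map euclideanreal euclideanreal (\<lambda>s. r * s)"
    by (auto intro!: continuous_intros)
  from continuous_map_compose[OF this \<gamma>]
  show "continuous_map euclideanreal (mtop M) (\<lambda>s. \<gamma> (r * s))" by (simp add: o_def)
next
  fix d assume "d \<in> charts_at M (\<gamma> (r * t))"
  then have "((snd d \<circ> \<gamma>) has_vector_derivative v d) (at (r * t))"
    using has_velocity_component[OF v] by blast
  moreover have "((\<lambda>s. r * s) has_vector_derivative r) (at t)"
    by (auto intro!: derivative_eq_intros)
  ultimately show "((snd d \<circ> (\<lambda>s. \<gamma> (r * s))) has_vector_derivative (r *\<^sub>R v) d) (at t)"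
    using vector_diff_chain_at[of "\<lambda>s. r * s" r t "snd d \<circ> \<gamma>" "v d"] by (simp add: o_def scaleR_fun_def)
next
  fix d assume "d \<notin> charts_at M (\<gamma> (r * t))"
  then show "(r *\<^sub>R v) d = 0"
    using has_velocity_zero[OF v] by (simp add: scaleR_fun_def)
qed

section \<open>Differentiable maps between manifolds\<close>

text \<open>
  Weaker than smoothness, but stable under composition and under fixing one argument of a map on a
  product, without any calculus of higher derivatives. Pushing forward velocities needs no more.
\<close>

definition differentiable_map ::
  "('a, 'e::banach) manifold \<Rightarrow> ('b, 'f::banach) manifold \<Rightarrow> ('a \<Rightarrow> 'b) \<Rightarrow> bool" where
  "differentiable_map M N f \<longleftrightarrow> continuous_map (mtop M) (mtop N) f \<and>
     (\<forall>x \<in> points M. \<forall>c \<in> charts_at M x. \<forall>d \<in> charts_at N (f x).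
        (snd d \<circ> f \<circ> chart_inv c) differentiable (at (snd c x)))"

lemma differentiable_map_continuous:
  "differentiable_map M N f \<Longrightarrow> continuous_map (mtop M) (mtop N) f"
  by (simp add: differentiable_map_def)

lemma differentiable_map_at:
  "differentiable_map M N f \<Longrightarrow> x \<in> points M \<Longrightarrow> c \<in> charts_at M x \<Longrightarrow> d \<in> charts_at N (f x) \<Longrightarrow>
    (snd d \<circ> f \<circ> chart_inv c) differentiable (at (snd c x))"
  unfolding differentiable_map_def by blast

lemma smooth_map_differentiable:
  assumes "smooth_map M N f"
  shows "differentiable_map M N f"
  unfolding differentiable_map_def
proof (intro conjI ballI)
  show "continuous_map (mtop M) (mtop N) f" using assms by (simp add: smooth_map_def)
next
  fix x c d assume c: "c \<in> charts_at M x" and d: "d \<in> charts_at N (f x)"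
  then have "smooth_on (snd c ` {x \<in> fst c. f x \<in> fst d}) (snd d \<circ> f \<circ> chart_inv c)"
    using assms unfolding smooth_map_def charts_at_iff by blast
  then show "(snd d \<circ> f \<circ> chart_inv c) differentiable (at (snd c x))"
    by (rule smooth_on_differentiable) (use c d in \<open>auto simp: charts_at_iff\<close>)
qed

lemma differentiable_map_compose:
  assumes M: "smooth_manifold M" and N: "smooth_manifold N"
    and f: "differentiable_map M N f" and g: "differentiable_map N P g"
  shows "differentiable_map M P (\<lambda>x. g (f x))"
  unfolding differentiable_map_def
proof (intro conjI ballI)
  show "continuous_map (mtop M) (mtop P) (\<lambda>x. g (f x))"
    using continuous_map_compose[OF f[THEN differentiable_map_continuous] g[THEN differentiable_map_continuous]]
    by (simp add: o_def)
next
  fix x c e assume x: "x \<in> points M" and c: "c \<in> charts_at M x" and e: "e \<in> charts_at P (g (f x))"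
  have cf: "continuous_map (mtop M) (mtop N) f" using f by (rule differentiable_map_continuous)
  have fx: "f x \<in> points N" using cf x continuous_map_image_subset_topspace by fastforce
  obtain d where d: "d \<in> charts_at N (f x)" using charts_at_nonempty[OF N fx] .
  have c': "c \<in> atlas M" "x \<in> fst c" and d': "d \<in> atlas N" "f x \<in> fst d"
    using c d by (simp_all add: charts_at_iff)
  have ev: "\<forall>\<^sub>F p in nhds (snd c x). (snd e \<circ> (\<lambda>x. g (f x)) \<circ> chart_inv c) p
      = (snd e \<circ> g \<circ> chart_inv d) ((snd d \<circ> f \<circ> chart_inv c) p)"
    using chart_eventually'[OF M cf c' chart_domain_open[OF N d'(1)] d'(2)]
    by eventually_elim (simp add: chart_inv_left[OF N d'(1)])
  have eq: "(snd d \<circ> f \<circ> chart_inv c) (snd c x) = snd d (f x)"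
    by (simp add: chart_inv_left[OF M c'])
  have "((snd e \<circ> g \<circ> chart_inv d) \<circ> (snd d \<circ> f \<circ> chart_inv c)) differentiable (at (snd c x))"
    by (rule differentiable_chain_at)
      (simp_all only: eq differentiable_map_at[OF f x c d] differentiable_map_at[OF g fx d e])
  then show "(snd e \<circ> (\<lambda>x. g (f x)) \<circ> chart_inv c) differentiable (at (snd c x))"
    by (intro differentiable_cong_nhds[OF ev]) (simp add: o_def)
qed

definition prod_chart :: "('a, 'e) chart \<Rightarrow> ('b, 'f) chart \<Rightarrow> ('a \<times> 'b, 'e \<times> 'f) chart" where
  "prod_chart c d = (fst c \<times> fst d, map_prod (snd c) (snd d))"

lemma prod_chart_atlas:
  "c \<in> atlas M \<Longrightarrow> d \<in> atlas N \<Longrightarrow> prod_chart c d \<in> atlas (prod_manifold M N)"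
  unfolding prod_chart_def prod_manifold_def by (simp only: manifold.simps mem_Collect_eq) blast

lemma prod_chart_charts_at:
  "c \<in> charts_at M x \<Longrightarrow> d \<in> charts_at N y \<Longrightarrow> prod_chart c d \<in> charts_at (prod_manifold M N) (x, y)"
  using prod_chart_atlas[of c M d N] by (simp add: charts_at_iff) (simp add: prod_chart_def)

lemma prod_chart_inv:
  assumes M: "smooth_manifold M" and N: "smooth_manifold N" and c: "c \<in> atlas M" and d: "d \<in> atlas N"
    and p: "p \<in> snd c ` fst c" and q: "q \<in> snd d ` fst d"
  shows "chart_inv (prod_chart c d) (p, q) = (chart_inv c p, chart_inv d q)"
proof -
  have "inj_on (snd (prod_chart c d)) (fst (prod_chart c d))"
    using map_prod_inj_on[OF chart_inj[OF M c] chart_inj[OF N d]] by (simp add: prod_chart_def)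
  moreover have "(chart_inv c p, chart_inv d q) \<in> fst (prod_chart c d)"
    using chart_inv_in[OF p] chart_inv_in[OF q] by (simp add: prod_chart_def)
  moreover have "snd (prod_chart c d) (chart_inv c p, chart_inv d q) = (p, q)"
    using chart_inv_right[OF p] chart_inv_right[OF q] by (simp add: prod_chart_def)
  ultimately show ?thesis unfolding chart_inv_def[of "prod_chart c d"] by (metis inv_into_f_f)
qed

lemma snd_prod_chart: "snd (prod_chart c d) (x, y) = (snd c x, snd d y)"
  by (simp add: prod_chart_def)

lemma points_prod_manifold: "points (prod_manifold M N) = points M \<times> points N"
  by (simp add: prod_manifold_def)

lemma eventually_chart_image:
  assumes M: "smooth_manifold M" and c: "c \<in> charts_at M x"
  shows "\<forall>\<^sub>F p in nhds (snd c x). p \<in> snd c ` fst c"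
  using eventually_nhds_in_open[OF chart_image_open[OF M]] c by (simp add: charts_at_iff)

lemma differentiable_map_left:
  assumes M: "smooth_manifold M" and N: "smooth_manifold N"
    and f: "differentiable_map (prod_manifold M N) P (\<lambda>(x, y). f x y)" and y: "y \<in> points N"
  shows "differentiable_map M P (\<lambda>x. f x y)"
  unfolding differentiable_map_def
proof (intro conjI ballI)
  have "continuous_map (mtop M) (prod_topology (mtop M) (mtop N)) (\<lambda>x. (x, y))"
    using y by (intro continuous_intros) auto
  from continuous_map_compose[OF this, of "mtop P" "\<lambda>(x, y). f x y"]
  show "continuous_map (mtop M) (mtop P) (\<lambda>x. f x y)"
    using differentiable_map_continuous[OF f] by (simp add: o_def prod_manifold_def)
next
  fix x c e assume x: "x \<in> points M" and c: "c \<in> charts_at M x" and e: "e \<in> charts_at P (f x y)"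
  obtain d where d: "d \<in> charts_at N y" using charts_at_nonempty[OF N y] .
  have c': "c \<in> atlas M" "x \<in> fst c" and d': "d \<in> atlas N" "y \<in> fst d"
    using c d by (simp_all add: charts_at_iff)
  have 1: "(snd e \<circ> (\<lambda>(x, y). f x y) \<circ> chart_inv (prod_chart c d)) differentiable (at (snd c x, snd d y))"
    using differentiable_map_at[OF f _ prod_chart_charts_at[OF c d], of e] x y e
    by (simp add: points_prod_manifold snd_prod_chart)
  have "(\<lambda>p. (p, snd d y)) differentiable (at (snd c x))"
    by (auto intro!: derivative_intros simp: differentiable_def)
  from differentiable_chain_at[OF this 1]
  have 2: "((snd e \<circ> (\<lambda>(x, y). f x y) \<circ> chart_inv (prod_chart c d)) \<circ> (\<lambda>p. (p, snd d y))) differentiable (at (snd c x))" .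
  show "(snd e \<circ> (\<lambda>x. f x y) \<circ> chart_inv c) differentiable (at (snd c x))"
  proof (rule differentiable_cong_nhds[OF _ 2])
    have yd: "snd d y \<in> snd d ` fst d" using d' by blast
    show "\<forall>\<^sub>F p in nhds (snd c x). (snd e \<circ> (\<lambda>x. f x y) \<circ> chart_inv c) p =
      ((snd e \<circ> (\<lambda>(x, y). f x y) \<circ> chart_inv (prod_chart c d)) \<circ> (\<lambda>p. (p, snd d y))) p"
      using eventually_chart_image[OF M c]
      by eventually_elim (simp add: prod_chart_inv[OF M N c'(1) d'(1) _ yd] chart_inv_left[OF N d'])
  qed
qed

lemma differentiable_map_right:
  assumes M: "smooth_manifold M" and N: "smooth_manifold N"
    and f: "differentiable_map (prod_manifold M N) P (\<lambda>(x, y). f x y)" and x: "x \<in> points M"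
  shows "differentiable_map N P (\<lambda>y. f x y)"
  unfolding differentiable_map_def
proof (intro conjI ballI)
  have "continuous_map (mtop N) (prod_topology (mtop M) (mtop N)) (\<lambda>y. (x, y))"
    using x by (intro continuous_intros) auto
  from continuous_map_compose[OF this, of "mtop P" "\<lambda>(x, y). f x y"]
  show "continuous_map (mtop N) (mtop P) (\<lambda>y. f x y)"
    using differentiable_map_continuous[OF f] by (simp add: o_def prod_manifold_def)
next
  fix y d e assume y: "y \<in> points N" and d: "d \<in> charts_at N y" and e: "e \<in> charts_at P (f x y)"
  obtain c where c: "c \<in> charts_at M x" using charts_at_nonempty[OF M x] .
  have c': "c \<in> atlas M" "x \<in> fst c" and d': "d \<in> atlas N" "y \<in> fst d"
    using c d by (simp_all add: charts_at_iff)
  have 1: "(snd e \<circ> (\<lambda>(x, y). f x y) \<circ> chart_inv (prod_chart c d)) differentiable (at (snd c x, snd d y))"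
    using differentiable_map_at[OF f _ prod_chart_charts_at[OF c d], of e] x y e
    by (simp add: points_prod_manifold snd_prod_chart)
  have "(\<lambda>q. (snd c x, q)) differentiable (at (snd d y))"
    by (auto intro!: derivative_intros simp: differentiable_def)
  from differentiable_chain_at[OF this 1]
  have 2: "((snd e \<circ> (\<lambda>(x, y). f x y) \<circ> chart_inv (prod_chart c d)) \<circ> (\<lambda>q. (snd c x, q))) differentiable (at (snd d y))" .
  show "(snd e \<circ> (\<lambda>y. f x y) \<circ> chart_inv d) differentiable (at (snd d y))"
  proof (rule differentiable_cong_nhds[OF _ 2])
    have xc: "snd c x \<in> snd c ` fst c" using c' by blast
    show "\<forall>\<^sub>F p in nhds (snd d y). (snd e \<circ> (\<lambda>y. f x y) \<circ> chart_inv d) p =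
      ((snd e \<circ> (\<lambda>(x, y). f x y) \<circ> chart_inv (prod_chart c d)) \<circ> (\<lambda>q. (snd c x, q))) p"
      using eventually_chart_image[OF N d]
      by eventually_elim (simp add: prod_chart_inv[OF M N c'(1) d'(1) xc] chart_inv_left[OF M c'])
  qed
qed

text \<open>
  The chain rule for curves; it carries all later computations with tangent maps.
\<close>

lemma push_velocity:
  assumes M: "smooth_manifold M" and N: "smooth_manifold N" and f: "differentiable_map M N f"
    and \<gamma>: "continuous_map euclideanreal (mtop M) \<gamma>" and v: "has_velocity M \<gamma> t v"
  shows "has_velocity N (\<lambda>s. f (\<gamma> s)) t (tangent_map M N f (\<gamma> t) v)"
    and "continuous_map euclideanreal (mtop N) (\<lambda>s. f (\<gamma> s))"
proof -
  show cont: "continuous_map euclideanreal (mtop N) (\<lambda>s. f (\<gamma> s))"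
    using continuous_map_compose[OF \<gamma> differentiable_map_continuous[OF f]] by (simp add: o_def)
  have x: "\<gamma> t \<in> points M" using \<gamma> continuous_map_image_subset_topspace by fastforce
  obtain c where c: "c \<in> charts_at M (\<gamma> t)" using charts_at_nonempty[OF M x] .
  show "has_velocity N (\<lambda>s. f (\<gamma> s)) t (tangent_map M N f (\<gamma> t) v)"
  proof (rule has_velocityI[OF N cont])
    fix d assume d: "d \<in> charts_at N (f (\<gamma> t))"
    from diff_fun_curve[OF M c \<gamma> v differentiable_map_at[OF f x c d]]
    show "((snd d \<circ> (\<lambda>s. f (\<gamma> s))) has_vector_derivative tangent_map M N f (\<gamma> t) v d) (at t)"
      using d by (simp add: tangent_map_def o_def)
  next
    fix d assume "d \<notin> charts_at N (f (\<gamma> t))"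
    then show "tangent_map M N f (\<gamma> t) v d = 0" by (simp add: tangent_map_def)
  qed
qed

lemma some_chart: "smooth_manifold M \<Longrightarrow> x \<in> points M \<Longrightarrow> (SOME c. c \<in> charts_at M x) \<in> charts_at M x"
  by (metis charts_at_nonempty someI)

lemma tangent_map_linear:
  assumes M: "smooth_manifold M" and f: "differentiable_map M N f" and x: "x \<in> points M"
  shows "tangent_map M N f x (v + w) = tangent_map M N f x v + tangent_map M N f x w"
    and "tangent_map M N f x (r *\<^sub>R v) = r *\<^sub>R tangent_map M N f x v"
proof -
  have lin: "linear (frechet_derivative (snd d \<circ> f \<circ> chart_inv (SOME c. c \<in> charts_at M x))
      (at (snd (SOME c. c \<in> charts_at M x) x)))" if "d \<in> charts_at N (f x)" for d
    using differentiable_map_at[OF f x some_chart[OF M x] that] linear_frechet_derivative by blast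
  show "tangent_map M N f x (v + w) = tangent_map M N f x v + tangent_map M N f x w"
  proof
    fix d
    show "tangent_map M N f x (v + w) d = (tangent_map M N f x v + tangent_map M N f x w) d"
      by (cases "d \<in> charts_at N (f x)")
        (simp_all add: tangent_map_def diff_fun_def Let_def linear_add[OF lin])
  qed
  show "tangent_map M N f x (r *\<^sub>R v) = r *\<^sub>R tangent_map M N f x v"
  proof
    fix d
    show "tangent_map M N f x (r *\<^sub>R v) d = (r *\<^sub>R tangent_map M N f x v) d"
      by (cases "d \<in> charts_at N (f x)")
        (simp_all add: tangent_map_def diff_fun_def Let_def scaleR_fun_def linear_scale[OF lin])
  qed
qed

lemma linear_transition:
  assumes "smooth_manifold M" "c \<in> charts_at M x" "d \<in> charts_at M x"
  shows "linear (frechet_derivative (snd d \<circ> chart_inv c) (at (snd c x)))"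
  using transition_differentiable[OF assms] by (rule linear_frechet_derivative)

lemma tangent_space_add:
  assumes M: "smooth_manifold M" and v: "v \<in> tangent_space M x" and w: "w \<in> tangent_space M x"
  shows "v + w \<in> tangent_space M x"
  unfolding tangent_space_def
proof (intro CollectI conjI allI ballI impI)
  show "(v + w) c = 0" if "c \<notin> charts_at M x" for c
    by (simp add: tangent_space_zero[OF v that] tangent_space_zero[OF w that])
  show "(v + w) d = frechet_derivative (snd d \<circ> chart_inv c) (at (snd c x)) ((v + w) c)"
    if c: "c \<in> charts_at M x" and d: "d \<in> charts_at M x" for c d
    by (simp only: plus_fun_apply linear_add[OF linear_transition[OF M c d]]
        tangent_space_transition[OF v c d, symmetric] tangent_space_transition[OF w c d, symmetric])
qed

lemma tangent_space_scale:
  assumes M: "smooth_manifold M" and v: "v \<in> tangent_space M x"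
  shows "r *\<^sub>R v \<in> tangent_space M x"
  unfolding tangent_space_def
proof (intro CollectI conjI allI ballI impI)
  show "(r *\<^sub>R v) c = 0" if "c \<notin> charts_at M x" for c
    by (simp add: scaleR_fun_def tangent_space_zero[OF v that])
  show "(r *\<^sub>R v) d = frechet_derivative (snd d \<circ> chart_inv c) (at (snd c x)) ((r *\<^sub>R v) c)"
    if c: "c \<in> charts_at M x" and d: "d \<in> charts_at M x" for c d
    by (simp only: scaleR_fun_def linear_scale[OF linear_transition[OF M c d]]
        tangent_space_transition[OF v c d, symmetric])
qed

lemma coord_vec_tangent:
  assumes M: "smooth_manifold M" and c: "c \<in> charts_at M x"
  shows "coord_vec M c x u \<in> tangent_space M x"
  unfolding tangent_space_def
proof (intro CollectI conjI allI ballI impI)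
  show "coord_vec M c x u d = 0" if "d \<notin> charts_at M x" for d using that by (simp add: coord_vec_def)
  fix d e assume d: "d \<in> charts_at M x" and e: "e \<in> charts_at M x"
  show "coord_vec M c x u e = frechet_derivative (snd e \<circ> chart_inv d) (at (snd d x)) (coord_vec M c x u d)"
    using frechet_derivative_at[OF change_chart_derivative[OF M d c transition_differentiable[OF M d e]]] d e
    by (simp add: coord_vec_def fun_eq_iff)
qed

lemma coord_vec_component:
  assumes "c \<in> charts_at M x" "v \<in> tangent_space M x"
  shows "coord_vec M c x (v c) = v"
proof
  fix d
  show "coord_vec M c x (v c) d = v d"
    using tangent_space_transition[OF assms(2,1), of d] tangent_space_zero[OF assms(2), of d]
    by (auto simp: coord_vec_def)
qed

lemma coord_vec_linear:
  assumes M: "smooth_manifold M" and c: "c \<in> charts_at M x"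
  shows "coord_vec M c x (u + v) = coord_vec M c x u + coord_vec M c x v"
    and "coord_vec M c x (r *\<^sub>R u) = r *\<^sub>R coord_vec M c x u"
  using linear_add[OF linear_transition[OF M c]] linear_scale[OF linear_transition[OF M c]]
  by (auto simp: coord_vec_def fun_eq_iff scaleR_fun_def)

text \<open>
  Coordinates identify the tangent space with the model space, which is finite-dimensional.
\<close>

lemma cotangent_bounded_linear:
  fixes f :: "('a, 'e::banach) tvec \<Rightarrow> real"
  assumes M: "smooth_manifold M" and c: "c \<in> charts_at M x"
    and add: "\<And>v w. v \<in> tangent_space M x \<Longrightarrow> w \<in> tangent_space M x \<Longrightarrow> f (v + w) = f v + f w"
    and scale: "\<And>r v. v \<in> tangent_space M x \<Longrightarrow> f (r *\<^sub>R v) = r * f v"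
  shows "bounded_linear (\<lambda>u. f (coord_vec M c x u))"
proof (rule finite_dim_bounded_linear)
  show "\<exists>B::'e set. finite B \<and> span B = UNIV" using M by (simp add: smooth_manifold_def)
  show "linear (\<lambda>u. f (coord_vec M c x u))"
    by (rule linearI) (simp_all add: coord_vec_linear[OF M c] add scale coord_vec_tangent[OF M c])
qed

section \<open>Homomorphisms from the real line\<close>

lemma (in group) local_hom_power:
  fixes Y :: "real \<Rightarrow> 'a"
  assumes Y: "\<And>t. \<bar>t\<bar> \<le> b \<Longrightarrow> Y t \<in> carrier G" and Y0: "Y 0 = \<one>"
    and hom: "\<And>s t. \<bar>s\<bar> \<le> b \<Longrightarrow> \<bar>t\<bar> \<le> b \<Longrightarrow> Y (s + t) = Y s \<otimes> Y t"
    and k: "k \<ge> 1" and u: "\<bar>u\<bar> \<le> b"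
  shows "Y (u / real k) [^] k = Y u"
proof -
  have "Y (u / real k) [^] j = Y (real j * (u / real k))" if "j \<le> k" for j
    using that
  proof (induction j)
    case 0
    then show ?case by (simp add: Y0)
  next
    case (Suc j)
    have le: "\<bar>real i * (u / real k)\<bar> \<le> b" if "i \<le> k" for i
    proof -
      have "\<bar>real i * (u / real k)\<bar> = (real i / real k) * \<bar>u\<bar>" by (simp add: abs_mult)
      also have "\<dots> \<le> 1 * \<bar>u\<bar>" using that k by (intro mult_right_mono) auto
      finally show ?thesis using u by simp
    qed
    have "Y (u / real k) [^] Suc j = Y (real j * (u / real k)) \<otimes> Y (u / real k)"
      using Suc by simp
    also have "\<dots> = Y (real j * (u / real k) + u / real k)"
      using le[of j] le[of 1] Suc.prems k by (intro hom[symmetric]) auto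
    finally show ?case by (simp add: algebra_simps add_divide_distrib)
  qed
  from this[of k] show ?thesis using k by simp
qed

text \<open>
  \<open>\<Gamma> t = Y (t / n) ^ n\<close> for large \<open>n\<close>. Two admissible exponents are compared through their product,
  and multiplicativity holds because the values of \<open>Y\<close> commute.
\<close>

lemma (in group) local_hom_extends:
  fixes Y :: "real \<Rightarrow> 'a"
  assumes b: "b > 0" and Y: "\<And>t. \<bar>t\<bar> \<le> b \<Longrightarrow> Y t \<in> carrier G"
    and hom: "\<And>s t. \<bar>s\<bar> \<le> b \<Longrightarrow> \<bar>t\<bar> \<le> b \<Longrightarrow> Y (s + t) = Y s \<otimes> Y t"
  shows "\<exists>\<Gamma>. (\<forall>t. \<Gamma> t \<in> carrier G) \<and> (\<forall>s t. \<Gamma> (s + t) = \<Gamma> s \<otimes> \<Gamma> t) \<and> (\<forall>t. \<bar>t\<bar> \<le> b \<longrightarrow> \<Gamma> t = Y t)"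
proof -
  have Y0: "Y 0 = \<one>"
    using hom[of 0 0] Y[of 0] b by (metis abs_zero add_0 less_eq_real_def r_cancel_one')
  have power: "Y (u / real k) [^] k = Y u" if "k \<ge> 1" "\<bar>u\<bar> \<le> b" for k u
    by (rule local_hom_power[where b=b]) (use Y Y0 hom that in auto)
  define n where "n t = nat \<lceil>\<bar>t\<bar> / b\<rceil> + 1" for t
  have n: "n t \<ge> 1" "\<bar>t\<bar> \<le> real (n t) * b" for t
  proof -
    have "\<bar>t\<bar> / b \<le> real (nat \<lceil>\<bar>t\<bar> / b\<rceil>)" by (rule real_nat_ceiling_ge)
    also have "\<dots> \<le> real (n t)" by (simp add: n_def)
    finally show "\<bar>t\<bar> \<le> real (n t) * b" using b by (simp add: divide_le_eq)
  qed (simp add: n_def)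
  have small: "\<bar>t / real k\<bar> \<le> b" if "k \<ge> 1" "\<bar>t\<bar> \<le> real k * b" for t k
    using that b by (simp add: divide_le_eq mult.commute)
  have common: "Y (t / real k) [^] k = Y (t / real (k * m)) [^] (k * m)"
    if k: "k \<ge> 1" "\<bar>t\<bar> \<le> real k * b" and m: "m \<ge> 1" for t k m
  proof -
    have "t / real (k * m) = (t / real k) / real m" by simp
    moreover have "Y (t / real k / real m) \<in> carrier G"
    proof (rule Y)
      have "\<bar>t / real k\<bar> / real m \<le> \<bar>t / real k\<bar> / 1"
        by (rule divide_left_mono) (use m in auto)
      then show "\<bar>t / real k / real m\<bar> \<le> b" using small[OF k] by simp
    qed
    ultimately have "Y (t / real (k * m)) [^] (k * m) = (Y (t / real k / real m) [^] m) [^] k"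
      by (simp add: nat_pow_pow mult.commute)
    then show ?thesis using power[OF m small[OF k]] by simp
  qed
  define \<Gamma> where "\<Gamma> t = Y (t / real (n t)) [^] n t" for t
  have \<Gamma>: "\<Gamma> t = Y (t / real k) [^] k" if "k \<ge> 1" "\<bar>t\<bar> \<le> real k * b" for t k
    using common[OF n[of t] that(1)] common[OF that n(1)[of t]] by (simp add: \<Gamma>_def mult.commute)
  have "\<Gamma> (s + t) = \<Gamma> s \<otimes> \<Gamma> t" for s t
  proof -
    define k where "k = n s + n t"
    have k1: "k \<ge> 1" using n(1)[of s] by (simp add: k_def)
    have ks: "\<bar>s\<bar> \<le> real k * b" and kt: "\<bar>t\<bar> \<le> real k * b" and kst: "\<bar>s + t\<bar> \<le> real k * b"
      using n(2)[of s] n(2)[of t] b by (auto simp: k_def distrib_right)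
    note s = small[OF k1 ks] and t = small[OF k1 kt]
    have comm: "Y (s / real k) \<otimes> Y (t / real k) = Y (t / real k) \<otimes> Y (s / real k)"
      using hom[OF s t] hom[OF t s] by (simp add: add.commute)
    have "\<Gamma> (s + t) = Y (s / real k + t / real k) [^] k"
      using \<Gamma>[OF k1 kst] by (simp add: add_divide_distrib)
    also have "\<dots> = (Y (s / real k) \<otimes> Y (t / real k)) [^] k" by (simp add: hom[OF s t])
    also have "\<dots> = Y (s / real k) [^] k \<otimes> Y (t / real k) [^] k"
      using pow_mult_distrib[OF comm Y[OF s] Y[OF t]] .
    finally show ?thesis by (simp add: \<Gamma>[OF k1 ks] \<Gamma>[OF k1 kt])
  qed
  moreover have "\<Gamma> t \<in> carrier G" for t
    unfolding \<Gamma>_def by (intro nat_pow_closed Y small n)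
  moreover have "\<Gamma> t = Y t" if "\<bar>t\<bar> \<le> b" for t
    using \<Gamma>[of 1 t] that Y[OF that] by simp
  ultimately show ?thesis by blast
qed

lemma (in group) real_hom_determined_locally:
  fixes \<Gamma> \<Delta> :: "real \<Rightarrow> 'a"
  assumes \<Gamma>: "\<And>t. \<Gamma> t \<in> carrier G" "\<And>s t. \<Gamma> (s + t) = \<Gamma> s \<otimes> \<Gamma> t"
    and \<Delta>: "\<And>t. \<Delta> t \<in> carrier G" "\<And>s t. \<Delta> (s + t) = \<Delta> s \<otimes> \<Delta> t"
    and b: "b > 0" and eq: "\<And>t. \<bar>t\<bar> \<le> b \<Longrightarrow> \<Gamma> t = \<Delta> t"
  shows "\<Gamma> = \<Delta>"
proof
  fix t
  obtain k :: nat where k: "k \<ge> 1" "\<bar>t\<bar> \<le> real k * b"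
  proof
    have "\<bar>t\<bar> / b \<le> real (nat \<lceil>\<bar>t\<bar> / b\<rceil>)" by (rule real_nat_ceiling_ge)
    also have "\<dots> \<le> real (nat \<lceil>\<bar>t\<bar> / b\<rceil> + 1)" by simp
    finally show "\<bar>t\<bar> \<le> real (nat \<lceil>\<bar>t\<bar> / b\<rceil> + 1) * b" using b by (simp add: divide_le_eq)
  qed simp
  have "\<Gamma> 0 = \<one>" "\<Delta> 0 = \<one>"
    using \<Gamma>(2)[of 0 0] \<Gamma>(1)[of 0] \<Delta>(2)[of 0 0] \<Delta>(1)[of 0] by (metis add_0 r_cancel_one')+
  then have "\<Gamma> t = \<Gamma> (t / real k) [^] k" "\<Delta> t = \<Delta> (t / real k) [^] k"
    using local_hom_power[of "\<bar>t\<bar>" \<Gamma> k t] local_hom_power[of "\<bar>t\<bar>" \<Delta> k t] \<Gamma> \<Delta> k(1) by auto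
  moreover have "\<bar>t / real k\<bar> \<le> b" using k b by (simp add: divide_le_eq mult.commute)
  ultimately show "\<Gamma> t = \<Delta> t" using eq by simp
qed

section \<open>Left-invariant vector fields\<close>

text \<open>
  A Lie group with a fixed chart at the identity, in which all differential equations are solved.
\<close>

locale lie_group_chart =
  fixes G :: "('g, 'f::banach) lie_group_data" (structure) and c :: "('g, 'f) chart"
  assumes lie: "lie_group G" and c: "c \<in> charts_at (mfd G) \<one>"
begin

lemma is_group: "group G" using lie by (simp add: lie_group_def)

end

sublocale lie_group_chart \<subseteq> group G by (rule is_group)

context lie_group_chart
begin

abbreviation "ci \<equiv> chart_inv c"
abbreviation "U \<equiv> snd c ` fst c"
abbreviation "p0 \<equiv> snd c \<one>"

definition "chart_mult = snd c \<circ> (\<lambda>(g, h). g \<otimes> h) \<circ> chart_inv (prod_chart c c)"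

text \<open>
  The left-invariant vector field with value \<open>u\<close> at the identity, in coordinates.
\<close>

definition "left_field u p = frechet_derivative (snd c \<circ> (\<lambda>h. ci p \<otimes> h) \<circ> ci) (at p0) u"

lemma manifold: "smooth_manifold (mfd G)" and points: "points (mfd G) = carrier G"
  and mult_smooth: "smooth_map (prod_manifold (mfd G) (mfd G)) (mfd G) (\<lambda>(g, h). g \<otimes> h)"
  and inv_smooth: "smooth_map (mfd G) (mfd G) (\<lambda>g. inv g)"
  using lie by (simp_all add: lie_group_def)

lemma c_atlas: "c \<in> atlas (mfd G)" and one_c: "\<one> \<in> fst c"
  using c by (simp_all add: charts_at_iff)

lemma charts_at_c: "g \<in> fst c \<Longrightarrow> c \<in> charts_at (mfd G) g"
  using c_atlas by (simp add: charts_at_iff)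

lemma ci_left: "g \<in> fst c \<Longrightarrow> ci (snd c g) = g"
  by (rule chart_inv_left[OF manifold c_atlas])

lemma c_carrier: "g \<in> fst c \<Longrightarrow> g \<in> carrier G"
  using chart_domain_subset[OF manifold c_atlas] points by blast

lemma ci_carrier: "p \<in> U \<Longrightarrow> ci p \<in> carrier G"
  by (intro c_carrier chart_inv_in)

lemma ci_p0: "ci p0 = \<one>" by (rule ci_left[OF one_c])

lemma p0_U: "p0 \<in> U" using one_c by blast

lemma U_open: "open U" by (rule chart_image_open[OF manifold c_atlas])

lemma left_mult_differentiable:
  "g \<in> carrier G \<Longrightarrow> differentiable_map (mfd G) (mfd G) (\<lambda>h. g \<otimes> h)"
  using differentiable_map_right[OF manifold manifold smooth_map_differentiable[OF mult_smooth]] points by simp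

lemma right_mult_differentiable:
  "g \<in> carrier G \<Longrightarrow> differentiable_map (mfd G) (mfd G) (\<lambda>h. h \<otimes> g)"
  using differentiable_map_left[OF manifold manifold smooth_map_differentiable[OF mult_smooth]] points by simp

lemma conj_differentiable:
  "g \<in> carrier G \<Longrightarrow> differentiable_map (mfd G) (mfd G) (\<lambda>h. g \<otimes> h \<otimes> inv g)"
  using differentiable_map_compose[OF manifold manifold left_mult_differentiable[of g] right_mult_differentiable[of "inv g"]]
  by simp

lemma chart_mult_eq:
  "p \<in> U \<Longrightarrow> q \<in> U \<Longrightarrow> chart_mult (p, q) = snd c (ci p \<otimes> ci q)"
  by (simp add: chart_mult_def prod_chart_inv[OF manifold manifold c_atlas c_atlas])

lemma chart_mult_C2:
  obtains W where "Ck_on 2 W chart_mult" "\<And>p q. p \<in> U \<Longrightarrow> q \<in> U \<Longrightarrow> ci p \<otimes> ci q \<in> fst c \<Longrightarrow> (p, q) \<in> W"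
proof
  let ?W = "snd (prod_chart c c) ` {z \<in> fst (prod_chart c c). (\<lambda>(g, h). g \<otimes> h) z \<in> fst c}"
  have "smooth_on ?W chart_mult"
    using mult_smooth prod_chart_atlas[OF c_atlas c_atlas] c_atlas
    unfolding smooth_map_def chart_mult_def by blast
  then show "Ck_on 2 ?W chart_mult" by (simp add: smooth_on_def)
  fix p q assume p: "p \<in> U" and q: "q \<in> U" and m: "ci p \<otimes> ci q \<in> fst c"
  show "(p, q) \<in> ?W"
  proof (rule image_eqI)
    show "(p, q) = snd (prod_chart c c) (ci p, ci q)"
      by (simp add: snd_prod_chart chart_inv_right[OF p] chart_inv_right[OF q])
    show "(ci p, ci q) \<in> {z \<in> fst (prod_chart c c). (\<lambda>(g, h). g \<otimes> h) z \<in> fst c}"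
      using m chart_inv_in[OF p] chart_inv_in[OF q] by (simp add: prod_chart_def)
  qed
qed

text \<open>
  The group law is used up to second derivatives: the first derivative defines left-invariant fields
  and \<open>Ad\<close>, and its differentiability gives the Lipschitz property and the bracket.
\<close>

lemma chart_mult_differentiable:
  assumes "p \<in> U" "q \<in> U" "ci p \<otimes> ci q \<in> fst c"
  shows "chart_mult differentiable (at (p, q))"
    and "(\<lambda>z. frechet_derivative chart_mult (at z) v) differentiable (at (p, q))"
proof -
  obtain W where W: "Ck_on 2 W chart_mult" "\<And>p q. p \<in> U \<Longrightarrow> q \<in> U \<Longrightarrow> ci p \<otimes> ci q \<in> fst c \<Longrightarrow> (p, q) \<in> W"
    using chart_mult_C2 by blast
  note in_W = W(2)[OF assms]
  have "Ck_on (Suc (Suc 0)) W chart_mult" using W(1) by (simp add: numeral_2_eq_2)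
  then show "chart_mult differentiable (at (p, q))"
    and "(\<lambda>z. frechet_derivative chart_mult (at z) v) differentiable (at (p, q))"
    unfolding Ck_on.simps(2) using in_W by blast+
qed

lemma near_one:
  assumes "differentiable_map (mfd G) (mfd G) f" "f \<one> \<in> fst d" "d \<in> atlas (mfd G)"
  shows "\<forall>\<^sub>F p in nhds p0. p \<in> U \<and> f (ci p) \<in> fst d"
  using chart_eventually'[OF manifold differentiable_map_continuous[OF assms(1)] c_atlas one_c
      chart_domain_open[OF manifold assms(3)] assms(2)] .

lemma left_field_eq:
  assumes p: "p \<in> U"
  shows "((snd c \<circ> (\<lambda>h. ci p \<otimes> h) \<circ> ci) has_derivative (\<lambda>u. frechet_derivative chart_mult (at (p, p0)) (0, u))) (at p0)"
    and "left_field u p = frechet_derivative chart_mult (at (p, p0)) (0, u)"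
proof -
  have cp: "ci p \<otimes> ci p0 \<in> fst c"
    using chart_inv_in[OF p] ci_carrier[OF p] by (simp add: ci_p0)
  have "(chart_mult has_derivative frechet_derivative chart_mult (at (p, p0))) (at (p, p0))"
    using chart_mult_differentiable(1)[OF p p0_U cp] frechet_derivative_works by blast
  moreover have "((\<lambda>q. (p, q)) has_derivative (\<lambda>u. (0, u))) (at p0)"
    by (auto intro!: derivative_eq_intros)
  ultimately have "((\<lambda>q. chart_mult (p, q)) has_derivative (\<lambda>u. frechet_derivative chart_mult (at (p, p0)) (0, u))) (at p0)"
    using has_derivative_compose[of "\<lambda>q. (p, q)" "\<lambda>u. (0, u)" p0 UNIV chart_mult] by blast
  moreover have "\<forall>\<^sub>F q in nhds p0. (snd c \<circ> (\<lambda>h. ci p \<otimes> h) \<circ> ci) q = chart_mult (p, q)"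
    using eventually_chart_image[OF manifold c] by eventually_elim (simp add: chart_mult_eq p)
  ultimately show *: "((snd c \<circ> (\<lambda>h. ci p \<otimes> h) \<circ> ci) has_derivative (\<lambda>u. frechet_derivative chart_mult (at (p, p0)) (0, u))) (at p0)"
    by (rule has_derivative_cong_nhds[rotated])
  show "left_field u p = frechet_derivative chart_mult (at (p, p0)) (0, u)"
    using frechet_derivative_at[OF *] by (simp add: left_field_def fun_eq_iff)
qed

lemma left_field_derivative:
  assumes p: "p \<in> U"
  shows "(left_field u has_derivative
     (\<lambda>w. frechet_derivative (\<lambda>z. frechet_derivative chart_mult (at z) (0, u)) (at (p, p0)) (w, 0))) (at p)"
proof -
  have cp: "ci p \<otimes> ci p0 \<in> fst c"
    using chart_inv_in[OF p] ci_carrier[OF p] by (simp add: ci_p0)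
  have "((\<lambda>z. frechet_derivative chart_mult (at z) (0, u)) has_derivative
      frechet_derivative (\<lambda>z. frechet_derivative chart_mult (at z) (0, u)) (at (p, p0))) (at (p, p0))"
    using chart_mult_differentiable(2)[OF p p0_U cp] frechet_derivative_works by blast
  moreover have "((\<lambda>q. (q, p0)) has_derivative (\<lambda>w. (w, 0))) (at p)"
    by (auto intro!: derivative_eq_intros)
  ultimately have "((\<lambda>q. frechet_derivative chart_mult (at (q, p0)) (0, u)) has_derivative
     (\<lambda>w. frechet_derivative (\<lambda>z. frechet_derivative chart_mult (at z) (0, u)) (at (p, p0)) (w, 0))) (at p)"
    using has_derivative_compose[of "\<lambda>q. (q, p0)" "\<lambda>w. (w, 0)" p UNIV "\<lambda>z. frechet_derivative chart_mult (at z) (0, u)"]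
    by blast
  moreover have "\<forall>\<^sub>F q in nhds p. left_field u q = frechet_derivative chart_mult (at (q, p0)) (0, u)"
    using eventually_nhds_in_open[OF U_open p] by eventually_elim (rule left_field_eq(2))
  ultimately show ?thesis by (rule has_derivative_cong_nhds[rotated])
qed

lemma left_field_lipschitz:
  "\<exists>r>0. \<exists>L\<ge>0. cball p0 r \<subseteq> U \<and>
    (\<forall>x\<in>cball p0 r. \<forall>y\<in>cball p0 r. norm (left_field u x - left_field u y) \<le> L * norm (x - y))"
proof (rule C1_locally_lipschitz[OF _ U_open p0_U left_field_derivative])
  show "\<exists>B::'f set. finite B \<and> span B = UNIV" using manifold by (simp add: smooth_manifold_def)
  fix w
  obtain W where W: "Ck_on 2 W chart_mult" "\<And>p q. p \<in> U \<Longrightarrow> q \<in> U \<Longrightarrow> ci p \<otimes> ci q \<in> fst c \<Longrightarrow> (p, q) \<in> W"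
    using chart_mult_C2 by blast
  have "Ck_on (Suc (Suc 0)) W chart_mult" using W(1) by (simp add: numeral_2_eq_2)
  then have cont: "continuous_on W (\<lambda>z. frechet_derivative (\<lambda>z. frechet_derivative chart_mult (at z) (0, u)) (at z) (w, 0))"
    by simp
  have W': "(p, p0) \<in> W" if "p \<in> U" for p
    using W(2)[OF that p0_U] chart_inv_in[OF that] ci_carrier[OF that] by (simp add: ci_p0)
  have "continuous_on U (\<lambda>p. (p, p0))" by (intro continuous_intros)
  from continuous_on_compose2[OF cont this]
  show "continuous_on U (\<lambda>p. frechet_derivative (\<lambda>z. frechet_derivative chart_mult (at z) (0, u)) (at (p, p0)) (w, 0))"
    using W' by blast
qed

text \<open>
  Left translation by \<open>g\<close> carries the field at \<open>h\<close> to the field at \<open>g h\<close>, because translations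
  compose.
\<close>

lemma left_field_invariant:
  assumes g: "g \<in> carrier G" and h: "h \<in> fst c" and gh: "g \<otimes> h \<in> fst c"
  shows "frechet_derivative (snd c \<circ> (\<lambda>k. g \<otimes> k) \<circ> ci) (at (snd c h)) (left_field u (snd c h))
    = left_field u (snd c (g \<otimes> h))"
proof -
  let ?L = "\<lambda>k. snd c \<circ> (\<lambda>x. k \<otimes> x) \<circ> ci"
  have hG: "h \<in> carrier G" by (rule c_carrier[OF h])
  have "(?L h has_derivative frechet_derivative (?L h) (at p0)) (at p0)"
    using differentiable_map_at[OF left_mult_differentiable[OF hG], of \<one> c c] hG c charts_at_c[OF h]
    by (simp add: points frechet_derivative_works)
  moreover have "(?L g has_derivative frechet_derivative (?L g) (at (snd c h))) (at (?L h p0))"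
    using differentiable_map_at[OF left_mult_differentiable[OF g] _ charts_at_c[OF h] charts_at_c[OF gh]] hG
    by (simp add: points frechet_derivative_works ci_p0)
  ultimately have "((\<lambda>q. ?L g (?L h q)) has_derivative
      (\<lambda>u. frechet_derivative (?L g) (at (snd c h)) (frechet_derivative (?L h) (at p0) u))) (at p0)"
    by (rule has_derivative_compose)
  moreover have "\<forall>\<^sub>F q in nhds p0. ?L (g \<otimes> h) q = ?L g (?L h q)"
    using near_one[OF left_mult_differentiable[OF hG] _ c_atlas]
  proof (rule eventually_mono)
    show "h \<otimes> \<one> \<in> fst c" using h hG by simp
    fix q assume "q \<in> U \<and> h \<otimes> ci q \<in> fst c"
    then show "?L (g \<otimes> h) q = ?L g (?L h q)"
      using g hG ci_carrier[of q] by (simp add: ci_left m_assoc)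
  qed
  ultimately have "(?L (g \<otimes> h) has_derivative
      (\<lambda>u. frechet_derivative (?L g) (at (snd c h)) (frechet_derivative (?L h) (at p0) u))) (at p0)"
    by (rule has_derivative_cong_nhds[rotated])
  from frechet_derivative_at[OF this] show ?thesis
    by (simp add: left_field_def ci_left h gh fun_eq_iff)
qed

end

section \<open>One-parameter subgroups and the exponential map\<close>

context lie_group_chart
begin

lemma one_parameter_facts:
  assumes "one_parameter_subgroup G \<gamma>"
  shows one_parameter_continuous: "continuous_map euclideanreal (mtop (mfd G)) \<gamma>"
    and one_parameter_add: "\<gamma> (s + t) = \<gamma> s \<otimes> \<gamma> t"
    and one_parameter_carrier: "\<gamma> t \<in> carrier G"
    and one_parameter_zero: "\<gamma> 0 = \<one>"
    and one_parameter_minus: "\<gamma> (- t) = inv (\<gamma> t)"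
proof -
  show 1: "continuous_map euclideanreal (mtop (mfd G)) \<gamma>" and 2: "\<gamma> (s + t) = \<gamma> s \<otimes> \<gamma> t" for s t
    using assms by (simp_all add: one_parameter_subgroup_def)
  show 3: "\<gamma> t \<in> carrier G" for t
    using continuous_map_image_subset_topspace[OF 1] points by auto
  show 4: "\<gamma> 0 = \<one>" using 2[of 0 0] 3[of 0] by (metis add_0 r_cancel_one')
  have "\<gamma> (- t) \<otimes> \<gamma> t = \<one>" using 2[of "- t" t] 4 by simp
  then show "\<gamma> (- t) = inv (\<gamma> t)" using 3 inv_equality by simp
qed

lemma one_parameter_integral_curve:
  assumes \<gamma>: "one_parameter_subgroup G \<gamma>" and v: "has_velocity (mfd G) \<gamma> 0 \<xi>" and t: "\<gamma> t \<in> fst c"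
  shows "((snd c \<circ> \<gamma>) has_vector_derivative left_field (\<xi> c) (snd c (\<gamma> t))) (at t)"
proof -
  note facts = one_parameter_facts[OF \<gamma>]
  have c0: "c \<in> charts_at (mfd G) (\<gamma> 0)" using c facts(4) by simp
  have "(snd c \<circ> (\<lambda>h. \<gamma> t \<otimes> h) \<circ> ci) differentiable (at p0)"
    using differentiable_map_at[OF left_mult_differentiable[OF facts(3)[of t]], of \<one> c c] facts(3)[of t] c
      charts_at_c[OF t] by (simp add: points)
  then have "((\<lambda>s. (snd c \<circ> (\<lambda>h. \<gamma> t \<otimes> h)) (\<gamma> s)) has_vector_derivative
      frechet_derivative (snd c \<circ> (\<lambda>h. \<gamma> t \<otimes> h) \<circ> ci) (at p0) (\<xi> c)) (at 0)"
    using curve_chart_derivative[OF manifold c0 facts(1) has_velocity_component[OF v c0],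
        of "snd c \<circ> (\<lambda>h. \<gamma> t \<otimes> h)"] by (simp add: facts(4))
  then have "((\<lambda>s. snd c (\<gamma> t \<otimes> \<gamma> s)) has_vector_derivative left_field (\<xi> c) (snd c (\<gamma> t))) (at (- t + t))"
    by (simp add: left_field_def ci_left[OF t])
  from has_vector_derivative_shift_at[OF this]
  show ?thesis by (simp add: facts(2)[symmetric] o_def)
qed

lemma one_parameter_near_zero:
  assumes \<gamma>: "one_parameter_subgroup G \<gamma>" and r: "r > 0"
  shows "\<forall>\<^sub>F t in nhds 0. \<gamma> t \<in> fst c \<and> snd c (\<gamma> t) \<in> cball p0 r"
proof -
  note facts = one_parameter_facts[OF \<gamma>]
  obtain N where N: "openin (mtop (mfd G)) N" "\<one> \<in> N" "N \<subseteq> fst c" "\<And>y. y \<in> N \<Longrightarrow> snd c y \<in> ball p0 r"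
    using chart_continuous_at[OF manifold c_atlas one_c, of "ball p0 r"] r by auto
  have "\<forall>\<^sub>F t in nhds 0. \<gamma> t \<in> N"
    using curve_eventually[OF facts(1) N(1), of 0] N(2) facts(4) by simp
  then show ?thesis
  proof eventually_elim
    case (elim t)
    have "ball p0 r \<subseteq> cball p0 r" by (rule ball_subset_cball)
    then show ?case using elim N(3) N(4) by blast
  qed
qed

lemma one_parameter_unique:
  assumes \<gamma>: "one_parameter_subgroup G \<gamma>" "has_velocity (mfd G) \<gamma> 0 \<xi>"
    and \<delta>: "one_parameter_subgroup G \<delta>" "has_velocity (mfd G) \<delta> 0 \<xi>"
  shows "\<gamma> = \<delta>"
proof -
  obtain r L where r: "r > 0" and L: "L \<ge> 0" and
    lip: "\<And>x y. x \<in> cball p0 r \<Longrightarrow> y \<in> cball p0 r \<Longrightarrow> norm (left_field (\<xi> c) x - left_field (\<xi> c) y) \<le> L * norm (x - y)"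
    using left_field_lipschitz[of "\<xi> c"] by blast
  have "\<forall>\<^sub>F t in nhds 0. (\<gamma> t \<in> fst c \<and> snd c (\<gamma> t) \<in> cball p0 r) \<and> (\<delta> t \<in> fst c \<and> snd c (\<delta> t) \<in> cball p0 r)"
    using one_parameter_near_zero[OF \<gamma>(1) r] one_parameter_near_zero[OF \<delta>(1) r] by (rule eventually_conj)
  then obtain a0 where a0: "a0 > 0" and near: "\<And>t. \<bar>t\<bar> \<le> a0 \<Longrightarrow>
      (\<gamma> t \<in> fst c \<and> snd c (\<gamma> t) \<in> cball p0 r) \<and> (\<delta> t \<in> fst c \<and> snd c (\<delta> t) \<in> cball p0 r)"
    by (rule eventually_near_zero) blast
  define a where "a = min a0 (1 / (2 * (L + 1)))"
  have a: "a > 0" "a \<le> a0" using a0 L by (auto simp: a_def)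
  have "L * a \<le> L * (1 / (2 * (L + 1)))" using L by (intro mult_left_mono) (auto simp: a_def)
  also have "\<dots> < 1" using L by (simp add: field_simps)
  finally have aL: "L * a < 1" .
  have eq: "(snd c \<circ> \<gamma>) t = (snd c \<circ> \<delta>) t" if t: "\<bar>t\<bar> \<le> a" for t
  proof (rule autonomous_ODE_unique[where S="cball p0 r" and F="left_field (\<xi> c)", OF lip L aL _ _ _ t])
    fix s assume "\<bar>s\<bar> \<le> a"
    then have s: "\<bar>s\<bar> \<le> a0" using a by simp
    show "(snd c \<circ> \<gamma>) s \<in> cball p0 r \<and>
      (snd c \<circ> \<gamma> has_vector_derivative left_field (\<xi> c) ((snd c \<circ> \<gamma>) s)) (at s)"
      using one_parameter_integral_curve[OF \<gamma>] near[OF s] by simp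
    show "(snd c \<circ> \<delta>) s \<in> cball p0 r \<and>
      (snd c \<circ> \<delta> has_vector_derivative left_field (\<xi> c) ((snd c \<circ> \<delta>) s)) (at s)"
      using one_parameter_integral_curve[OF \<delta>] near[OF s] by simp
  next
    show "(snd c \<circ> \<gamma>) 0 = (snd c \<circ> \<delta>) 0"
      by (simp add: one_parameter_zero[OF \<gamma>(1)] one_parameter_zero[OF \<delta>(1)])
  qed
  show ?thesis
  proof (rule real_hom_determined_locally[where b=a])
    fix t :: real assume t: "\<bar>t\<bar> \<le> a"
    then have "\<gamma> t \<in> fst c" "\<delta> t \<in> fst c" using near[of t] a by auto
    then show "\<gamma> t = \<delta> t" using eq[OF t] by (metis ci_left o_apply)
  qed (use a one_parameter_facts[OF \<gamma>(1)] one_parameter_facts[OF \<delta>(1)] in auto)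
qed

lemma left_field_one: "left_field u p0 = u"
proof -
  have "\<forall>\<^sub>F q in nhds p0. (snd c \<circ> (\<lambda>h. ci p0 \<otimes> h) \<circ> ci) q = q"
    using eventually_chart_image[OF manifold c]
    by eventually_elim (simp add: ci_p0 ci_carrier chart_inv_right)
  from fun_cong[OF frechet_derivative_at[OF has_derivative_cong_nhds[OF this has_derivative_ident]], of u]
  show ?thesis unfolding left_field_def by (rule sym)
qed

text \<open>
  For small \<open>s\<close> the curves \<open>t \<mapsto> y (s + t)\<close> and \<open>t \<mapsto> y s \<cdot> y t\<close> both solve the equation of the
  left-invariant field, with the same initial value; so the integral curve is a local homomorphism.
  The bounds on \<open>b\<close> keep both curves in the ball where the field is Lipschitz.
\<close>

lemma one_parameter_local:
  "\<exists>b>0. \<exists>y. y 0 = p0 \<and> (\<forall>t. \<bar>t\<bar> \<le> b \<longrightarrow> y t \<in> U) \<and> (y has_vector_derivative u) (at 0) \<and>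
     (\<forall>s t. \<bar>s\<bar> \<le> b \<longrightarrow> \<bar>t\<bar> \<le> b \<longrightarrow> ci (y (s + t)) = ci (y s) \<otimes> ci (y t))"
proof -
  obtain r L where r: "r > 0" and L: "L \<ge> 0" and rU: "cball p0 r \<subseteq> U" and
    lip: "\<And>x y. x \<in> cball p0 r \<Longrightarrow> y \<in> cball p0 r \<Longrightarrow> norm (left_field u x - left_field u y) \<le> L * norm (x - y)"
    using left_field_lipschitz[of u] by blast
  obtain a y where a: "a > 0" and y0: "y 0 = p0" and yr: "\<And>t. t \<in> {-a..a} \<Longrightarrow> y t \<in> cball p0 r"
    and yd: "\<And>t. t \<in> {-a<..<a} \<Longrightarrow> (y has_vector_derivative left_field u (y t)) (at t)"
    using autonomous_ODE_exists[of r L p0 "left_field u", OF r L lip] by blast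
  obtain N where N: "openin (mtop (mfd G)) N" "\<one> \<in> N" "N \<subseteq> fst c" "\<And>g. g \<in> N \<Longrightarrow> snd c g \<in> ball p0 r"
    using chart_continuous_at[OF manifold c_atlas one_c, of "ball p0 r"] r by auto
  have "continuous_map (prod_topology (mtop (mfd G)) (mtop (mfd G))) (mtop (mfd G)) (\<lambda>(g, h). g \<otimes> h)"
    using mult_smooth by (simp add: smooth_map_def prod_manifold_def)
  from openin_continuous_map_preimage[OF this N(1)]
  have "openin (prod_topology (mtop (mfd G)) (mtop (mfd G)))
      {z \<in> carrier G \<times> carrier G. (\<lambda>(g, h). g \<otimes> h) z \<in> N}"
    by (simp add: points)
  moreover have "(\<one>, \<one>) \<in> {z \<in> carrier G \<times> carrier G. (\<lambda>(g, h). g \<otimes> h) z \<in> N}" using N(2) by simp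
  ultimately have "\<exists>V1 V2. openin (mtop (mfd G)) V1 \<and> openin (mtop (mfd G)) V2 \<and> \<one> \<in> V1 \<and> \<one> \<in> V2 \<and>
      V1 \<times> V2 \<subseteq> {z \<in> carrier G \<times> carrier G. (\<lambda>(g, h). g \<otimes> h) z \<in> N}"
    by (rule prod_topology_neighbourhood)
  then obtain V1 V2 where V: "openin (mtop (mfd G)) V1" "openin (mtop (mfd G)) V2" "\<one> \<in> V1" "\<one> \<in> V2"
    "V1 \<times> V2 \<subseteq> {z \<in> carrier G \<times> carrier G. (\<lambda>(g, h). g \<otimes> h) z \<in> N}"
    by blast
  have V12: "openin (mtop (mfd G)) (V1 \<inter> V2)" "\<one> \<in> V1 \<inter> V2" using V by auto
  have cont: "isCont y 0"
    using has_vector_derivative_continuous[OF yd[of 0]] a by simp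
  have "\<forall>\<^sub>F p in nhds (y 0). p \<in> U \<and> ci p \<in> V1 \<inter> V2"
    unfolding y0 by (rule chart_eventually[OF manifold c_atlas one_c V12])
  from eventually_tendsto_nhds[where y=y and t=0, OF this cont]
  have "\<forall>\<^sub>F t in nhds 0. y t \<in> U \<and> ci (y t) \<in> V1 \<inter> V2" .
  then obtain b0 where b0: "b0 > 0" and near: "\<And>t. \<bar>t\<bar> \<le> b0 \<Longrightarrow> y t \<in> U \<and> ci (y t) \<in> V1 \<inter> V2"
    by (rule eventually_near_zero) blast
  define b where "b = min b0 (min (a/3) (1 / (2 * (L + 1))))"
  have b: "b > 0" "b \<le> b0" "b \<le> a/3" using b0 a L by (auto simp: b_def)
  have "L * b \<le> L * (1 / (2 * (L + 1)))" using L by (intro mult_left_mono) (auto simp: b_def)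
  also have "\<dots> < 1" using L by (simp add: field_simps)
  finally have bL: "L * b < 1" .
  have hom: "ci (y (s + t)) = ci (y s) \<otimes> ci (y t)" if s: "\<bar>s\<bar> \<le> b" and t: "\<bar>t\<bar> \<le> b" for s t
  proof -
    have ys: "y s \<in> U" "ci (y s) \<in> V1" and Gs: "ci (y s) \<in> carrier G"
      using near[of s] s b ci_carrier by auto
    have prod: "y x \<in> U" "ci (y x) \<in> fst c" "ci (y s) \<otimes> ci (y x) \<in> N" if x: "\<bar>x\<bar> \<le> b" for x
    proof -
      show x': "y x \<in> U" using near[of x] x b by auto
      show "ci (y x) \<in> fst c" by (rule chart_inv_in[OF x'])
      have "(ci (y s), ci (y x)) \<in> V1 \<times> V2" using near[of x] x b ys by auto
      from subsetD[OF V(5) this] show "ci (y s) \<otimes> ci (y x) \<in> N" by simp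
    qed
    have "y (s + t) = snd c (ci (y s) \<otimes> ci (y t))"
    proof (rule autonomous_ODE_unique[where S="cball p0 r" and F="left_field u" and
            y="\<lambda>t. y (s + t)" and z="\<lambda>t. snd c (ci (y s) \<otimes> ci (y t))", OF lip L bL _ _ _ t])
      fix x assume x: "\<bar>x\<bar> \<le> b"
      have sx: "s + x \<in> {-a<..<a}" using s x b a by auto
      show "y (s + x) \<in> cball p0 r \<and> ((\<lambda>t. y (s + t)) has_vector_derivative left_field u (y (s + x))) (at x)"
        using sx by (intro conjI yr has_vector_derivative_shift_at[OF yd[OF sx]]) simp
      have xa: "x \<in> {-a<..<a}" using x b a by auto
      have gh: "ci (y s) \<otimes> ci (y x) \<in> fst c" by (rule subsetD[OF N(3) prod(3)[OF x]])
      have cx: "snd c (ci (y x)) = y x" by (rule chart_inv_right[OF prod(1)[OF x]])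
      have "((snd c \<circ> (\<lambda>h. ci (y s) \<otimes> h) \<circ> ci) has_derivative
          frechet_derivative (snd c \<circ> (\<lambda>h. ci (y s) \<otimes> h) \<circ> ci) (at (y x))) (at (y x))"
        using differentiable_map_at[OF left_mult_differentiable[OF Gs] _ charts_at_c[OF prod(2)[OF x]] charts_at_c[OF gh]]
          ci_carrier[OF prod(1)[OF x]] by (simp add: points cx frechet_derivative_works)
      from vector_derivative_chain[OF yd[OF xa] this]
      have "((\<lambda>t. snd c (ci (y s) \<otimes> ci (y t))) has_vector_derivative
          frechet_derivative (snd c \<circ> (\<lambda>h. ci (y s) \<otimes> h) \<circ> ci) (at (y x)) (left_field u (y x))) (at x)"
        by simp
      then have "((\<lambda>t. snd c (ci (y s) \<otimes> ci (y t))) has_vector_derivative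
          left_field u (snd c (ci (y s) \<otimes> ci (y x)))) (at x)"
        using left_field_invariant[OF Gs prod(2)[OF x] gh, of u] by (simp add: cx)
      moreover have "snd c (ci (y s) \<otimes> ci (y x)) \<in> cball p0 r"
        by (rule subsetD[OF ball_subset_cball N(4)[OF prod(3)[OF x]]])
      ultimately show "snd c (ci (y s) \<otimes> ci (y x)) \<in> cball p0 r \<and>
          ((\<lambda>t. snd c (ci (y s) \<otimes> ci (y t))) has_vector_derivative left_field u (snd c (ci (y s) \<otimes> ci (y x)))) (at x)"
        by blast
    next
      show "y (s + 0) = snd c (ci (y s) \<otimes> ci (y 0))"
        using Gs chart_inv_right[OF ys(1)] by (simp add: y0 ci_p0)
    qed
    then show ?thesis using ci_left[OF subsetD[OF N(3) prod(3)[OF t]]] by simp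
  qed
  moreover have "(y has_vector_derivative u) (at 0)"
    using yd[of 0] a by (simp add: y0 left_field_one)
  moreover have "y t \<in> U" if "\<bar>t\<bar> \<le> b" for t using near[of t] that b by auto
  ultimately show ?thesis using b(1) y0 by blast
qed

text \<open>
  Continuity of the extended homomorphism at \<open>t\<close> follows from that at zero by left translation.
\<close>

lemma one_parameter_exists:
  assumes \<xi>: "\<xi> \<in> lie_algebra G"
  shows "\<exists>\<gamma>. one_parameter_subgroup G \<gamma> \<and> has_velocity (mfd G) \<gamma> 0 \<xi>"
proof -
  obtain b y where b: "b > 0" and y0: "y 0 = p0" and yU: "\<And>t. \<bar>t\<bar> \<le> b \<Longrightarrow> y t \<in> U"
    and yd: "(y has_vector_derivative \<xi> c) (at 0)"
    and hom: "\<And>s t. \<bar>s\<bar> \<le> b \<Longrightarrow> \<bar>t\<bar> \<le> b \<Longrightarrow> ci (y (s + t)) = ci (y s) \<otimes> ci (y t)"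
    using one_parameter_local[of "\<xi> c"] by blast
  have "\<exists>\<gamma>. (\<forall>t. \<gamma> t \<in> carrier G) \<and> (\<forall>s t. \<gamma> (s + t) = \<gamma> s \<otimes> \<gamma> t) \<and> (\<forall>t. \<bar>t\<bar> \<le> b \<longrightarrow> \<gamma> t = ci (y t))"
    by (rule local_hom_extends[OF b]) (use ci_carrier yU hom in auto)
  then obtain \<gamma> where \<gamma>: "\<And>t. \<gamma> t \<in> carrier G" "\<And>s t. \<gamma> (s + t) = \<gamma> s \<otimes> \<gamma> t"
    "\<And>t. \<bar>t\<bar> \<le> b \<Longrightarrow> \<gamma> t = ci (y t)" by blast
  have \<gamma>0: "\<gamma> 0 = \<one>" using \<gamma>(3)[of 0] b by (simp add: y0 ci_p0)
  have cy: "isCont y 0" using has_vector_derivative_continuous[OF yd] by simp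
  have small: "\<forall>\<^sub>F s in nhds (0::real). \<bar>s\<bar> \<le> b"
    unfolding eventually_nhds_metric using b by (intro exI[of _ b]) auto
  have "continuous_map euclideanreal (mtop (mfd G)) \<gamma>"
    unfolding continuous_map_def
  proof (intro conjI allI impI)
    show "\<gamma> \<in> topspace euclideanreal \<rightarrow> topspace (mtop (mfd G))" using \<gamma>(1) by (simp add: points)
    fix V assume V: "openin (mtop (mfd G)) V"
    have "\<forall>\<^sub>F s in nhds t. \<gamma> s \<in> V" if t: "\<gamma> t \<in> V" for t
    proof -
      have "\<forall>\<^sub>F p in nhds (y 0). p \<in> U \<and> \<gamma> t \<otimes> ci p \<in> V"
        using chart_eventually'[OF manifold differentiable_map_continuous[OF left_mult_differentiable[OF \<gamma>(1)[of t]]]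
            c_atlas one_c V] t \<gamma>(1)[of t] by (simp add: y0)
      from eventually_tendsto_nhds[OF this cy] small
      have "\<forall>\<^sub>F s in nhds 0. \<gamma> (t + s) \<in> V"
        by eventually_elim (simp add: \<gamma>(2,3))
      then have "\<forall>\<^sub>F s in nhds (t - t). \<gamma> (t + s) \<in> V" by simp
      from eventually_tendsto_nhds[where y="\<lambda>s. s - t" and t=t, OF this]
      show ?thesis by simp
    qed
    then have "open {s. \<gamma> s \<in> V}"
      by (intro open_if_eventually) simp
    then show "openin euclideanreal {s \<in> topspace euclideanreal. \<gamma> s \<in> V}" by simp
  qed
  note cont = this
  have "one_parameter_subgroup G \<gamma>" using cont \<gamma>(2) by (simp add: one_parameter_subgroup_def)
  moreover have "has_velocity (mfd G) \<gamma> 0 \<xi>"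
  proof (rule has_velocityI[OF manifold cont])
    fix d assume "d \<in> charts_at (mfd G) (\<gamma> 0)"
    then have d: "d \<in> charts_at (mfd G) \<one>" by (simp add: \<gamma>0)
    have "((snd d \<circ> ci) has_derivative frechet_derivative (snd d \<circ> ci) (at p0)) (at (y 0))"
      using transition_differentiable[OF manifold c d] by (simp add: y0 frechet_derivative_works)
    from vector_derivative_chain[OF yd this]
    have "((\<lambda>s. (snd d \<circ> ci) (y s)) has_vector_derivative \<xi> d) (at 0)"
      using tangent_space_transition[OF \<xi>[unfolded lie_algebra_def] c d] by simp
    moreover have "\<forall>\<^sub>F s in nhds 0. (snd d \<circ> \<gamma>) s = (snd d \<circ> ci) (y s)"
      using small by eventually_elim (simp add: \<gamma>(3))
    ultimately show "((snd d \<circ> \<gamma>) has_vector_derivative \<xi> d) (at 0)"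
      by (rule has_vector_derivative_cong_nhds[rotated])
  next
    fix d assume "d \<notin> charts_at (mfd G) (\<gamma> 0)"
    then show "\<xi> d = 0" unfolding \<gamma>0 by (rule tangent_space_zero[OF \<xi>[unfolded lie_algebra_def]])
  qed
  ultimately show ?thesis by blast
qed

definition "exp_curve \<xi> = (THE \<gamma>. one_parameter_subgroup G \<gamma> \<and> has_velocity (mfd G) \<gamma> 0 \<xi>)"

lemma exp_curve_eq:
  assumes "one_parameter_subgroup G \<gamma>" "has_velocity (mfd G) \<gamma> 0 \<xi>"
  shows "exp_curve \<xi> = \<gamma>"
  unfolding exp_curve_def using assms one_parameter_unique by (intro the_equality) blast+

lemma exp_curve:
  assumes "\<xi> \<in> lie_algebra G"
  shows exp_curve_subgroup: "one_parameter_subgroup G (exp_curve \<xi>)"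
    and exp_curve_velocity: "has_velocity (mfd G) (exp_curve \<xi>) 0 \<xi>"
  using one_parameter_exists[OF assms] exp_curve_eq by metis+

lemma lie_exp_scale:
  assumes \<xi>: "\<xi> \<in> lie_algebra G"
  shows "lie_exp G (t *\<^sub>R \<xi>) = exp_curve \<xi> t"
proof -
  note sub = exp_curve_subgroup[OF \<xi>]
  have "continuous_map euclideanreal euclideanreal (\<lambda>s. t * s)" by (auto intro!: continuous_intros)
  from continuous_map_compose[OF this one_parameter_continuous[OF sub]]
  have "one_parameter_subgroup G (\<lambda>s. exp_curve \<xi> (t * s))"
    by (simp add: one_parameter_subgroup_def o_def distrib_left one_parameter_add[OF sub])
  moreover have "has_velocity (mfd G) (\<lambda>s. exp_curve \<xi> (t * s)) 0 (t *\<^sub>R \<xi>)"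
    using has_velocity_scale[OF manifold one_parameter_continuous[OF sub], of t 0 \<xi>] exp_curve_velocity[OF \<xi>] by simp
  ultimately have "exp_curve (t *\<^sub>R \<xi>) = (\<lambda>s. exp_curve \<xi> (t * s))" by (rule exp_curve_eq)
  then show ?thesis by (simp add: lie_exp_def exp_curve_def[symmetric])
qed

end

section \<open>The adjoint representation and the bracket\<close>

context lie_group_chart
begin

lemma conj_one: "g \<in> carrier G \<Longrightarrow> g \<otimes> \<one> \<otimes> inv g = \<one>"
  by simp

lemma Ad_velocity:
  assumes g: "g \<in> carrier G" and \<gamma>: "continuous_map euclideanreal (mtop (mfd G)) \<gamma>"
    and v: "has_velocity (mfd G) \<gamma> 0 \<xi>" and \<gamma>0: "\<gamma> 0 = \<one>"
  shows "has_velocity (mfd G) (\<lambda>t. g \<otimes> \<gamma> t \<otimes> inv g) 0 (Ad G g \<xi>)"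
    and "continuous_map euclideanreal (mtop (mfd G)) (\<lambda>t. g \<otimes> \<gamma> t \<otimes> inv g)"
  using push_velocity[OF manifold manifold conj_differentiable[OF g] \<gamma> v] by (simp_all add: Ad_def \<gamma>0)

lemma Ad_closed:
  assumes g: "g \<in> carrier G" and \<xi>: "\<xi> \<in> lie_algebra G"
  shows "Ad G g \<xi> \<in> lie_algebra G"
proof -
  note sub = exp_curve_subgroup[OF \<xi>]
  from has_velocity_tangent[OF Ad_velocity(1)[OF g one_parameter_continuous[OF sub] exp_curve_velocity[OF \<xi>] one_parameter_zero[OF sub]]]
  show ?thesis using conj_one[OF g] by (simp add: lie_algebra_def one_parameter_zero[OF sub])
qed

definition "chart_inverse = snd c \<circ> (\<lambda>g. inv g) \<circ> ci"

text \<open>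
  Conjugation is \<open>h \<mapsto> (g h) g\<^sup>-\<^sup>1\<close>, so its differential is that of the first factor of the product,
  applied to the left-invariant field at \<open>g\<close>. In this form the dependence on \<open>g\<close> involves only one derivative
  of the group law.
\<close>

lemma Ad_in_chart:
  assumes p: "p \<in> U" and ip: "inv (ci p) \<in> fst c" and \<xi>: "\<xi> \<in> lie_algebra G"
  shows "Ad G (ci p) \<xi> c = frechet_derivative chart_mult (at (p, chart_inverse p)) (left_field (\<xi> c) p, 0)"
proof -
  define g where "g = ci p"
  have g: "g \<in> carrier G" and gc: "g \<in> fst c" and cg: "snd c g = p"
    using ci_carrier[OF p] chart_inv_in[OF p] chart_inv_right[OF p] by (simp_all add: g_def)
  let ?L = "snd c \<circ> (\<lambda>h. g \<otimes> h) \<circ> ci" and ?K = "snd c \<circ> (\<lambda>h. g \<otimes> h \<otimes> inv g) \<circ> ci"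
  have i: "chart_inverse p = snd c (inv g)" by (simp add: chart_inverse_def g_def)
  have iU: "chart_inverse p \<in> U" using ip by (simp add: i g_def)
  have ci_i: "ci (chart_inverse p) = inv g" using ci_left[OF ip] by (simp add: i g_def)
  have Lp0: "?L p0 = p" using g by (simp add: ci_p0 cg)
  have L: "(?L has_derivative (\<lambda>u. left_field u p)) (at p0)"
    using left_field_eq[OF p] by (simp add: g_def)
  have "ci p \<otimes> ci (chart_inverse p) \<in> fst c"
    using g one_c by (simp add: ci_i g_def[symmetric])
  then have "(chart_mult has_derivative frechet_derivative chart_mult (at (p, chart_inverse p))) (at (?L p0, chart_inverse p))"
    using chart_mult_differentiable(1)[OF p iU] unfolding Lp0 by (simp add: frechet_derivative_works)
  moreover have "((\<lambda>q. (?L q, chart_inverse p)) has_derivative (\<lambda>u. (left_field u p, 0))) (at p0)"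
    by (intro has_derivative_Pair L has_derivative_const)
  ultimately have "((\<lambda>q. chart_mult (?L q, chart_inverse p)) has_derivative
      (\<lambda>u. frechet_derivative chart_mult (at (p, chart_inverse p)) (left_field u p, 0))) (at p0)"
    by (rule has_derivative_compose[rotated])
  moreover have "\<forall>\<^sub>F q in nhds p0. ?K q = chart_mult (?L q, chart_inverse p)"
  proof (rule eventually_mono)
    show "\<forall>\<^sub>F q in nhds p0. q \<in> U \<and> g \<otimes> ci q \<in> fst c"
      by (rule near_one[OF left_mult_differentiable[OF g] _ c_atlas]) (use g gc in simp)
    fix q assume q: "q \<in> U \<and> g \<otimes> ci q \<in> fst c"
    then have "?L q \<in> U" by simp
    from chart_mult_eq[OF this iU] show "?K q = chart_mult (?L q, chart_inverse p)"
      using q by (simp add: ci_i ci_left)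
  qed
  ultimately have K: "(?K has_derivative
      (\<lambda>u. frechet_derivative chart_mult (at (p, chart_inverse p)) (left_field u p, 0))) (at p0)"
    by (rule has_derivative_cong_nhds[rotated])
  have "c \<in> charts_at (mfd G) (g \<otimes> \<one> \<otimes> inv g)" using c conj_one[OF g] by simp
  then have "Ad G g \<xi> c = diff_fun (mfd G) (snd c \<circ> (\<lambda>h. g \<otimes> h \<otimes> inv g)) \<one> \<xi>"
    by (simp add: Ad_def tangent_map_def)
  also have "\<dots> = frechet_derivative ?K (at p0) (\<xi> c)"
    using K by (intro diff_fun_chart[OF manifold c \<xi>[unfolded lie_algebra_def]]) (rule differentiableI)
  also have "\<dots> = frechet_derivative chart_mult (at (p, chart_inverse p)) (left_field (\<xi> c) p, 0)"
    using fun_cong[OF frechet_derivative_at[OF K], of "\<xi> c"] by (rule sym)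
  finally show ?thesis by (simp add: g_def)
qed

lemma Ad_chart_differentiable:
  assumes \<xi>: "\<xi> \<in> lie_algebra G"
  shows "((\<lambda>g. Ad G g \<xi> c) \<circ> ci) differentiable (at p0)"
proof (rule differentiable_cong_nhds)
  have inv_diff: "differentiable_map (mfd G) (mfd G) (\<lambda>g. inv g)"
    by (rule smooth_map_differentiable[OF inv_smooth])
  have near: "\<forall>\<^sub>F p in nhds p0. p \<in> U \<and> inv (ci p) \<in> fst c"
    by (rule near_one[OF inv_diff _ c_atlas]) (simp add: one_c)
  show "\<forall>\<^sub>F p in nhds p0. ((\<lambda>g. Ad G g \<xi> c) \<circ> ci) p =
      frechet_derivative chart_mult (at (p, chart_inverse p)) (left_field (\<xi> c) p, 0)"
    using near by eventually_elim (simp add: Ad_in_chart[OF _ _ \<xi>])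
  show "(\<lambda>p. frechet_derivative chart_mult (at (p, chart_inverse p)) (left_field (\<xi> c) p, 0)) differentiable (at p0)"
  proof (rule differentiable_linear_family[where A="\<lambda>p v. frechet_derivative chart_mult (at (p, chart_inverse p)) (v, 0)"])
    show "\<exists>B::'f set. finite B \<and> span B = UNIV" using manifold by (simp add: smooth_manifold_def)
    show "left_field (\<xi> c) differentiable (at p0)"
      by (rule differentiableI[OF left_field_derivative[OF p0_U]])
    show "\<forall>\<^sub>F p in nhds p0. linear (\<lambda>v. frechet_derivative chart_mult (at (p, chart_inverse p)) (v, 0))"
      using near
    proof eventually_elim
      case (elim p)
      have "chart_mult differentiable (at (p, chart_inverse p))"
      proof (rule chart_mult_differentiable(1))
        show "p \<in> U" "chart_inverse p \<in> U" using elim by (auto simp: chart_inverse_def)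
        show "ci p \<otimes> ci (chart_inverse p) \<in> fst c"
          using elim ci_carrier[of p] one_c by (simp add: chart_inverse_def ci_left)
      qed
      then have "linear (frechet_derivative chart_mult (at (p, chart_inverse p)))"
        by (rule linear_frechet_derivative)
      moreover have "linear (\<lambda>v. (v, 0) :: 'f \<times> 'f)" by (rule linearI) auto
      ultimately show ?case using linear_compose by (fastforce simp: o_def)
    qed
    fix b
    have i0: "chart_inverse p0 = p0" by (simp add: chart_inverse_def ci_p0)
    have "chart_inverse differentiable (at p0)"
      using differentiable_map_at[OF inv_diff, of \<one> c c] c by (simp add: points chart_inverse_def)
    then have "(\<lambda>p. (p, chart_inverse p)) differentiable (at p0)"
      by (auto simp: differentiable_def intro!: has_derivative_Pair has_derivative_ident)
    moreover have "(\<lambda>z. frechet_derivative chart_mult (at z) (b, 0)) differentiable (at (p0, chart_inverse p0))"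
      unfolding i0 by (rule chart_mult_differentiable(2)[OF p0_U p0_U]) (simp add: ci_p0 one_c)
    ultimately have "((\<lambda>z. frechet_derivative chart_mult (at z) (b, 0)) \<circ> (\<lambda>p. (p, chart_inverse p))) differentiable (at p0)"
      by (rule differentiable_chain_at)
    then show "(\<lambda>p. frechet_derivative chart_mult (at (p, chart_inverse p)) (b, 0)) differentiable (at p0)"
      by (simp add: o_def)
  qed
qed

lemma dual_lie_algebra_bounded_linear:
  assumes "f \<in> dual_lie_algebra G"
  shows "bounded_linear (\<lambda>u. f (coord_vec (mfd G) c \<one> u))"
proof (rule cotangent_bounded_linear[OF manifold c])
  show "f (v + w) = f v + f w" if "v \<in> tangent_space (mfd G) \<one>" "w \<in> tangent_space (mfd G) \<one>" for v w
    using assms that unfolding dual_lie_algebra_def lie_algebra_def by blast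
  show "f (r *\<^sub>R v) = r * f v" if "v \<in> tangent_space (mfd G) \<one>" for r v
    using assms that unfolding dual_lie_algebra_def lie_algebra_def by blast
qed

text \<open>
  A functional is a bounded linear function of the single component \<open>\<zeta> c\<close>, so the derivative of that
  component of \<open>Ad g \<xi>\<close> suffices. That the bracket lies in the Lie algebra is assumed: semisimplicity
  supplies it for the brackets of interest.
\<close>

lemma lie_bracket_derivative:
  assumes \<xi>: "\<xi> \<in> lie_algebra G" and \<eta>: "\<eta> \<in> lie_algebra G"
    and br: "lie_bracket G \<eta> \<xi> \<in> lie_algebra G" and f: "f \<in> dual_lie_algebra G"
  shows "((\<lambda>t. f (Ad G (exp_curve \<eta> t) \<xi>)) has_vector_derivative f (lie_bracket G \<eta> \<xi>)) (at 0)"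
proof -
  note sub = exp_curve_subgroup[OF \<eta>]
  have c0: "c \<in> charts_at (mfd G) (exp_curve \<eta> 0)" using c by (simp add: one_parameter_zero[OF sub])
  have "((\<lambda>t. Ad G (exp_curve \<eta> t) \<xi> c) has_vector_derivative
      diff_fun (mfd G) (\<lambda>g. Ad G g \<xi> c) (exp_curve \<eta> 0) \<eta>) (at 0)"
    by (rule diff_fun_curve[OF manifold c0 one_parameter_continuous[OF sub] exp_curve_velocity[OF \<eta>]])
      (simp only: one_parameter_zero[OF sub] Ad_chart_differentiable[OF \<xi>])
  then have *: "((\<lambda>t. Ad G (exp_curve \<eta> t) \<xi> c) has_vector_derivative lie_bracket G \<eta> \<xi> c) (at 0)"
    by (simp add: lie_bracket_def one_parameter_zero[OF sub])
  have coord: "coord_vec (mfd G) c \<one> (\<zeta> c) = \<zeta>" if "\<zeta> \<in> lie_algebra G" for \<zeta>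
    using coord_vec_component[OF c] that by (simp add: lie_algebra_def)
  from bounded_linear.has_vector_derivative[OF dual_lie_algebra_bounded_linear[OF f] *]
  show ?thesis
    by (simp add: coord[OF br] coord[OF Ad_closed[OF one_parameter_carrier[OF sub] \<xi>]])
qed

lemma lie_bracket_derivative_minus:
  assumes \<xi>: "\<xi> \<in> lie_algebra G" and \<eta>: "\<eta> \<in> lie_algebra G"
    and br: "lie_bracket G \<eta> \<xi> \<in> lie_algebra G" and f: "f \<in> dual_lie_algebra G"
  shows "((\<lambda>t. f (Ad G (exp_curve \<eta> (- t)) \<xi>)) has_vector_derivative - f (lie_bracket G \<eta> \<xi>)) (at 0)"
proof -
  have "(uminus has_vector_derivative - 1) (at (0::real))"
    by (auto intro!: derivative_eq_intros)
  from vector_diff_chain_at[OF this, of "\<lambda>t. f (Ad G (exp_curve \<eta> t) \<xi>)"] lie_bracket_derivative[OF assms]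
  show ?thesis by (simp add: o_def)
qed

section \<open>Endomorphisms of a Lie group\<close>

text \<open>
  Naturality of the exponential map: an endomorphism maps one-parameter subgroups to one-parameter
  subgroups.
\<close>

lemma endomorphism_exp:
  assumes s: "differentiable_map (mfd G) (mfd G) s" and hom: "s \<in> hom G G" and \<xi>: "\<xi> \<in> lie_algebra G"
  shows "tangent_map (mfd G) (mfd G) s \<one> \<xi> \<in> lie_algebra G"
    and "exp_curve (tangent_map (mfd G) (mfd G) s \<one> \<xi>) = (\<lambda>t. s (exp_curve \<xi> t))"
proof -
  note sub = exp_curve_subgroup[OF \<xi>]
  have s1: "s \<one> = \<one>" using hom_one[OF hom is_group is_group] .
  note push = push_velocity[OF manifold manifold s one_parameter_continuous[OF sub] exp_curve_velocity[OF \<xi>], unfolded one_parameter_zero[OF sub]]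
  show "tangent_map (mfd G) (mfd G) s \<one> \<xi> \<in> lie_algebra G"
    using has_velocity_tangent[OF push(1)] by (simp add: one_parameter_zero[OF sub] s1 lie_algebra_def)
  have "one_parameter_subgroup G (\<lambda>t. s (exp_curve \<xi> t))"
    using push(2) by (simp add: one_parameter_subgroup_def one_parameter_add[OF sub]
        hom_mult[OF hom] one_parameter_carrier[OF sub])
  then show "exp_curve (tangent_map (mfd G) (mfd G) s \<one> \<xi>) = (\<lambda>t. s (exp_curve \<xi> t))"
    using push(1) by (rule exp_curve_eq)
qed

lemma endomorphism_Ad:
  assumes s: "differentiable_map (mfd G) (mfd G) s" and hom: "s \<in> hom G G" and \<xi>: "\<xi> \<in> lie_algebra G"
    and g: "g \<in> carrier G"
  shows "tangent_map (mfd G) (mfd G) s \<one> (Ad G g \<xi>) = Ad G (s g) (tangent_map (mfd G) (mfd G) s \<one> \<xi>)"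
proof -
  note sub = exp_curve_subgroup[OF \<xi>]
  note vel = exp_curve_velocity[OF \<xi>] and cont = one_parameter_continuous[OF sub] and zero = one_parameter_zero[OF sub]
  have s1: "s \<one> = \<one>" using hom_one[OF hom is_group is_group] .
  have sg: "s g \<in> carrier G" using hom_in_carrier[OF hom g] .
  interpret s: group_hom G G s by unfold_locales (rule hom)
  note push = push_velocity[OF manifold manifold s cont vel, unfolded zero]
  have "has_velocity (mfd G) (\<lambda>t. s (g \<otimes> exp_curve \<xi> t \<otimes> inv g)) 0
      (tangent_map (mfd G) (mfd G) s \<one> (Ad G g \<xi>))"
    using push_velocity(1)[OF manifold manifold s Ad_velocity(2,1)[OF g cont vel zero]] conj_one[OF g]
    by (simp add: zero)
  moreover have "has_velocity (mfd G) (\<lambda>t. s g \<otimes> s (exp_curve \<xi> t) \<otimes> inv (s g)) 0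
      (Ad G (s g) (tangent_map (mfd G) (mfd G) s \<one> \<xi>))"
    by (rule Ad_velocity(1)[OF sg push(2,1)]) (simp add: zero s1)
  moreover have "s (g \<otimes> exp_curve \<xi> t \<otimes> inv g) = s g \<otimes> s (exp_curve \<xi> t) \<otimes> inv (s g)" for t
    using g one_parameter_carrier[OF sub, of t] by simp
  ultimately show ?thesis using has_velocity_unique by simp
qed

section \<open>Moment maps along one-parameter subgroups\<close>

lemma action_curve:
  assumes M: "smooth_manifold M" and \<alpha>: "smooth_action G M \<alpha>" and x: "x \<in> points M" and \<xi>: "\<xi> \<in> lie_algebra G"
  shows "has_velocity M (\<lambda>t. \<alpha> (exp_curve \<xi> t) x) 0 (action_field G M \<alpha> \<xi> x)"
    and "continuous_map euclideanreal (mtop M) (\<lambda>t. \<alpha> (exp_curve \<xi> t) x)"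
    and "\<alpha> (exp_curve \<xi> 0) x = x"
proof -
  note sub = exp_curve_subgroup[OF \<xi>]
  have "differentiable_map (mfd G) M (\<lambda>g. \<alpha> g x)"
    using \<alpha> by (intro differentiable_map_left[OF manifold M _ x] smooth_map_differentiable)
      (simp add: smooth_action_def)
  note push = push_velocity[OF manifold M this one_parameter_continuous[OF sub] exp_curve_velocity[OF \<xi>]]
  show "continuous_map euclideanreal (mtop M) (\<lambda>t. \<alpha> (exp_curve \<xi> t) x)" by (rule push(2))
  show "has_velocity M (\<lambda>t. \<alpha> (exp_curve \<xi> t) x) 0 (action_field G M \<alpha> \<xi> x)"
    using push(1) velocity_eq[OF push(1)] by (simp add: action_field_def lie_exp_scale[OF \<xi>])
  interpret group_action G "points M" \<alpha> using \<alpha> by (simp add: smooth_action_def)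
  show "\<alpha> (exp_curve \<xi> 0) x = x"
    using id_eq_one x by (metis one_parameter_zero[OF sub] restrict_apply')
qed

text \<open>
  Both defining properties of a moment map meet here: equivariance rewrites the curve as
  \<open>\<langle>\<mu> (exp (t \<eta>). x), \<xi>\<rangle>\<close>, and the moment map equation computes the derivative of the latter.
\<close>

lemma moment_map_Ad_derivative:
  assumes M: "smooth_manifold M" and \<alpha>: "smooth_action G M \<alpha>" and \<mu>: "moment_map G M \<omega> \<alpha> \<mu>"
    and x: "x \<in> points M" and \<xi>: "\<xi> \<in> lie_algebra G" and \<eta>: "\<eta> \<in> lie_algebra G"
  shows "((\<lambda>t. \<mu> x (Ad G (exp_curve \<eta> (- t)) \<xi>)) has_vector_derivative
    \<omega> x (action_field G M \<alpha> \<xi> x) (action_field G M \<alpha> \<eta> x)) (at 0)"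
proof -
  note sub = exp_curve_subgroup[OF \<eta>]
  note curve = action_curve[OF M \<alpha> x \<eta>]
  let ?v = "action_field G M \<alpha> \<eta> x"
  have v: "?v \<in> tangent_space M x" using has_velocity_tangent[OF curve(1)] by (simp add: curve(3))
  obtain d where d: "d \<in> charts_at M x" using charts_at_nonempty[OF M x] .
  have "smooth_fun M (\<lambda>x. \<mu> x \<xi>)" using \<mu> \<xi> by (simp add: moment_map_def)
  then have "((\<lambda>x. \<mu> x \<xi>) \<circ> chart_inv d) differentiable (at (snd d x))"
    using d by (intro smooth_on_differentiable[where S="snd d ` fst d"]) (auto simp: smooth_fun_def charts_at_iff)
  then have "((\<lambda>t. \<mu> (\<alpha> (exp_curve \<eta> t) x) \<xi>) has_vector_derivative diff_fun M (\<lambda>x. \<mu> x \<xi>) x ?v) (at 0)"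
    using diff_fun_curve[OF M _ curve(2,1), of d "\<lambda>x. \<mu> x \<xi>"] d by (simp add: curve(3))
  moreover have "diff_fun M (\<lambda>x. \<mu> x \<xi>) x ?v = \<omega> x (action_field G M \<alpha> \<xi> x) ?v"
  proof -
    have "dual_diff G M \<mu> x ?v \<xi> = \<omega> x (action_field G M \<alpha> \<xi> x) ?v"
      using \<mu> x v \<xi> unfolding moment_map_def by blast
    then show ?thesis using \<xi> by (simp add: dual_diff_def)
  qed
  moreover have "\<mu> (\<alpha> (exp_curve \<eta> t) x) \<xi> = \<mu> x (Ad G (exp_curve \<eta> (- t)) \<xi>)" for t
  proof -
    have "\<mu> (\<alpha> (exp_curve \<eta> t) x) = coadjoint G (exp_curve \<eta> t) (\<mu> x)"
      using \<mu> x one_parameter_carrier[OF sub] unfolding moment_map_def by blast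
    then show ?thesis using \<xi> by (simp add: coadjoint_def one_parameter_minus[OF sub])
  qed
  ultimately show ?thesis by simp
qed

lemma moment_map_bracket:
  assumes M: "smooth_manifold M" and \<alpha>: "smooth_action G M \<alpha>" and \<mu>: "moment_map G M \<omega> \<alpha> \<mu>"
    and x: "x \<in> points M" and \<xi>: "\<xi> \<in> lie_algebra G" and \<eta>: "\<eta> \<in> lie_algebra G"
    and br: "lie_bracket G \<eta> \<xi> \<in> lie_algebra G"
  shows "\<mu> x (lie_bracket G \<eta> \<xi>) = - \<omega> x (action_field G M \<alpha> \<xi> x) (action_field G M \<alpha> \<eta> x)"
proof -
  have "\<mu> x \<in> dual_lie_algebra G" using \<mu> x by (auto simp: moment_map_def)
  from vector_derivative_unique_at[OF lie_bracket_derivative_minus[OF \<xi> \<eta> br this]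
      moment_map_Ad_derivative[OF M \<alpha> \<mu> x \<xi> \<eta>]]
  show ?thesis by simp
qed

end

section \<open>Semisimplicity and functionals on the Lie algebra\<close>

text \<open>
  In a simple summand \<open>I\<close> the brackets span an ideal \<open>J\<close> of \<open>I\<close>, since \<open>br x y\<close> with \<open>y\<close> in \<open>J \<subseteq> I\<close> is
  again one of the spanning brackets; \<open>J\<close> is nonzero as \<open>I\<close> is not abelian, so \<open>J = I\<close>.
\<close>

lemma semisimple_span_brackets:
  fixes br :: "'v::real_vector \<Rightarrow> 'v \<Rightarrow> 'v"
  assumes "semisimple_lie_algebra br L"
  shows "L \<subseteq> span {br x y | x y. x \<in> L \<and> y \<in> L \<and> br x y \<in> L}" (is "_ \<subseteq> span ?S")
proof -
  obtain \<I> where I: "\<And>I. I \<in> \<I> \<Longrightarrow> lie_ideal br L I" "\<And>I. I \<in> \<I> \<Longrightarrow> simple_lie_algebra br I"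
    and span: "span (\<Union>\<I>) = L"
    using assms unfolding semisimple_lie_algebra_def by blast
  have "I \<subseteq> span ?S" if ideal_I: "I \<in> \<I>" for I
  proof -
    have sub: "subspace I" and IL: "I \<subseteq> L" and ideal: "\<And>x y. x \<in> L \<Longrightarrow> y \<in> I \<Longrightarrow> br x y \<in> I"
      using I(1)[OF ideal_I] unfolding lie_ideal_def by blast+
    define J where "J = span {br x y | x y. x \<in> I \<and> y \<in> I}"
    have JI: "J \<subseteq> I" unfolding J_def using sub IL ideal by (intro span_minimal) auto
    have "lie_ideal br I J"
      unfolding lie_ideal_def
    proof (intro conjI ballI)
      show "subspace J" by (simp add: J_def)
      fix x y assume "x \<in> I" "y \<in> J"
      then show "br x y \<in> J" unfolding J_def using JI J_def by (intro span_base) auto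
    qed (rule JI)
    moreover have "J \<noteq> {0}"
    proof -
      obtain x y where "x \<in> I" "y \<in> I" "br x y \<noteq> 0"
        using I(2)[OF ideal_I] unfolding simple_lie_algebra_def by blast
      moreover from this have "br x y \<in> J" unfolding J_def by (intro span_base) auto
      ultimately show ?thesis by blast
    qed
    ultimately have "J = I" using I(2)[OF ideal_I] unfolding simple_lie_algebra_def by blast
    moreover have "J \<subseteq> span ?S" unfolding J_def using IL ideal by (intro span_mono) blast
    ultimately show ?thesis by simp
  qed
  then have "span (\<Union>\<I>) \<subseteq> span ?S" by (intro span_minimal) auto
  then show ?thesis by (simp add: span)
qed

lemma dual_lie_algebra_eqI:
  fixes G :: "('g, 'f::banach) lie_group_data"
  assumes G: "smooth_manifold (mfd G)" and f: "f \<in> dual_lie_algebra G" and g: "g \<in> dual_lie_algebra G"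
    and S: "S \<subseteq> lie_algebra G" "lie_algebra G \<subseteq> span S" and eq: "\<And>\<zeta>. \<zeta> \<in> S \<Longrightarrow> f \<zeta> = g \<zeta>"
  shows "f = g"
proof (rule extensionalityI)
  show "f \<in> extensional (lie_algebra G)" "g \<in> extensional (lie_algebra G)"
    using f g by (simp_all add: dual_lie_algebra_def)
  have add: "h (v + w) = h v + h w" if "h \<in> dual_lie_algebra G" "v \<in> lie_algebra G" "w \<in> lie_algebra G" for h v w
    using that unfolding dual_lie_algebra_def by blast
  have scale: "h (r *\<^sub>R v) = r * h v" if "h \<in> dual_lie_algebra G" "v \<in> lie_algebra G" for h r v
    using that unfolding dual_lie_algebra_def by blast
  fix \<zeta> assume \<zeta>: "\<zeta> \<in> lie_algebra G"
  have zero: "0 \<in> lie_algebra G"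
    using tangent_space_scale[OF G \<zeta>[unfolded lie_algebra_def], of 0] by (simp add: lie_algebra_def)
  define T where "T = {\<zeta> \<in> lie_algebra G. f \<zeta> = g \<zeta>}"
  have "subspace T"
  proof (rule subspaceI)
    show "0 \<in> T" using scale[OF f zero, of 0] scale[OF g zero, of 0] zero by (simp add: T_def)
  next
    fix v w assume "v \<in> T" "w \<in> T"
    then have v: "v \<in> lie_algebra G" "f v = g v" and w: "w \<in> lie_algebra G" "f w = g w"
      by (simp_all add: T_def)
    have "v + w \<in> lie_algebra G"
      using v(1) w(1) tangent_space_add[OF G] unfolding lie_algebra_def by blast
    moreover have "f (v + w) = g (v + w)"
      using add[OF f v(1) w(1)] add[OF g v(1) w(1)] v(2) w(2) by (simp only:)
    ultimately show "v + w \<in> T" unfolding T_def by blast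
  next
    fix r v assume "v \<in> T"
    then have v: "v \<in> lie_algebra G" "f v = g v" by (simp_all add: T_def)
    have "r *\<^sub>R v \<in> lie_algebra G"
      using v(1) tangent_space_scale[OF G] unfolding lie_algebra_def by blast
    moreover have "f (r *\<^sub>R v) = g (r *\<^sub>R v)"
      using scale[OF f v(1)] scale[OF g v(1)] v(2) by (simp only:)
    ultimately show "r *\<^sub>R v \<in> T" unfolding T_def by blast
  qed
  moreover have "S \<subseteq> T" using S(1) eq unfolding T_def by blast
  ultimately have "span S \<subseteq> T" by (intro span_minimal)
  then show "f \<zeta> = g \<zeta>" using \<zeta> S(2) unfolding T_def by blast
qed

section \<open>Equivariance of the moment map\<close>

lemma aut_dual_closed:
  fixes G :: "('g, 'f::banach) lie_group_data"
  assumes G: "lie_group G" and f: "f \<in> dual_lie_algebra G"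
    and s: "differentiable_map (mfd G) (mfd G) (\<sigma> (inv\<^bsub>W\<^esub> w))" "\<sigma> (inv\<^bsub>W\<^esub> w) \<in> hom G G"
  shows "aut_dual G W \<sigma> w f \<in> dual_lie_algebra G"
proof -
  have manifold: "smooth_manifold (mfd G)" and one: "\<one>\<^bsub>G\<^esub> \<in> points (mfd G)"
    using G group.is_monoid monoid.one_closed unfolding lie_group_def by metis+
  obtain c where "c \<in> charts_at (mfd G) \<one>\<^bsub>G\<^esub>" using charts_at_nonempty[OF manifold one] .
  then interpret lie_group_chart G c using G by unfold_locales
  let ?T = "tangent_map (mfd G) (mfd G) (\<sigma> (inv\<^bsub>W\<^esub> w)) \<one>\<^bsub>G\<^esub>"
  note closed = endomorphism_exp(1)[OF s] and lin = tangent_map_linear[OF manifold s(1) one]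
  have add: "f (v + w) = f v + f w" if "v \<in> lie_algebra G" "w \<in> lie_algebra G" for v w
    using that f unfolding dual_lie_algebra_def by blast
  have scale: "f (r *\<^sub>R v) = r * f v" if "v \<in> lie_algebra G" for r v
    using that f unfolding dual_lie_algebra_def by blast
  show ?thesis
    unfolding dual_lie_algebra_def aut_dual_def aut_lie_algebra_def
  proof (intro CollectI conjI ballI allI restrict_extensional)
    fix v w assume v: "v \<in> lie_algebra G" and w: "w \<in> lie_algebra G"
    then have "v + w \<in> lie_algebra G" using tangent_space_add[OF manifold] unfolding lie_algebra_def by blast
    then show "(\<lambda>\<xi>\<in>lie_algebra G. f (?T \<xi>)) (v + w) =
        (\<lambda>\<xi>\<in>lie_algebra G. f (?T \<xi>)) v + (\<lambda>\<xi>\<in>lie_algebra G. f (?T \<xi>)) w"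
      using v w by (simp only: restrict_apply' lin(1) add[OF closed[OF v] closed[OF w]])
  next
    fix r v assume v: "v \<in> lie_algebra G"
    then have "r *\<^sub>R v \<in> lie_algebra G" using tangent_space_scale[OF manifold] unfolding lie_algebra_def by blast
    then show "(\<lambda>\<xi>\<in>lie_algebra G. f (?T \<xi>)) (r *\<^sub>R v) = r * (\<lambda>\<xi>\<in>lie_algebra G. f (?T \<xi>)) v"
      using v by (simp only: restrict_apply' lin(2) scale[OF closed[OF v]])
  qed
qed

lemma lie_aut_carrier:
  assumes "f \<in> carrier (lie_aut G)"
  shows "f \<in> hom G G" "f \<in> Bij (carrier G)" "differentiable_map (mfd G) (mfd G) f"
  using assms smooth_map_differentiable unfolding lie_aut_def auto_def by auto

lemma lie_aut_mult:
  assumes "f \<in> carrier (lie_aut G)" "h \<in> carrier (lie_aut G)" "g \<in> carrier G"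
  shows "(f \<otimes>\<^bsub>lie_aut G\<^esub> h) g = f (h g)"
  using lie_aut_carrier(2)[OF assms(1)] lie_aut_carrier(2)[OF assms(2)] assms(3)
  by (simp add: lie_aut_def BijGroup_def compose_def)

text \<open>
  The identity of \<open>W\<close> acts by an idempotent bijection, that is, by the identity map.
\<close>

lemma lie_aut_action_inverse:
  assumes W: "group W" and \<sigma>: "\<sigma> \<in> hom W (lie_aut G)" and w: "w \<in> carrier W" and g: "g \<in> carrier G"
  shows "\<sigma> w (\<sigma> (inv\<^bsub>W\<^esub> w) g) = g"
proof -
  interpret W: group W by (rule W)
  have cl: "\<sigma> v \<in> carrier (lie_aut G)" if "v \<in> carrier W" for v using hom_in_carrier[OF \<sigma> that] .
  have mult: "\<sigma> u (\<sigma> v k) = \<sigma> (u \<otimes>\<^bsub>W\<^esub> v) k" if "u \<in> carrier W" "v \<in> carrier W" "k \<in> carrier G" for u v k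
    using hom_mult[OF \<sigma> that(1,2)] lie_aut_mult[OF cl[OF that(1)] cl[OF that(2)] that(3)] by simp
  have bij: "bij_betw (\<sigma> \<one>\<^bsub>W\<^esub>) (carrier G) (carrier G)"
    using lie_aut_carrier(2)[OF cl[OF W.one_closed]] by (simp add: Bij_def)
  then have "\<sigma> \<one>\<^bsub>W\<^esub> g \<in> carrier G" using g bij_betwE by blast
  moreover have "\<sigma> \<one>\<^bsub>W\<^esub> (\<sigma> \<one>\<^bsub>W\<^esub> g) = \<sigma> \<one>\<^bsub>W\<^esub> g" using mult[of "\<one>\<^bsub>W\<^esub>" "\<one>\<^bsub>W\<^esub>" g] g by simp
  ultimately have "\<sigma> \<one>\<^bsub>W\<^esub> g = g" using bij g unfolding bij_betw_def by (meson inj_onD)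
  then show ?thesis using mult[of w "inv\<^bsub>W\<^esub> w" g] w g by simp
qed

theorem mainTheorem2:
  fixes M :: "('a, 'e::banach) manifold"
    and \<omega> :: "('a, 'e) two_form"
    and G :: "('g, 'f::banach) lie_group_data"
    and \<alpha> :: "'g \<Rightarrow> 'a \<Rightarrow> 'a"
    and \<mu> :: "'a \<Rightarrow> ('g, 'f) tvec \<Rightarrow> real"
    and \<Omega> :: "('g \<Rightarrow> 'g) set set"
    and \<sigma> :: "('g \<Rightarrow> 'g) set \<Rightarrow> 'g \<Rightarrow> 'g"
    and \<rho> :: "('g \<Rightarrow> 'g) set \<Rightarrow> 'a \<Rightarrow> 'a"
  assumes "symplectic_manifold M \<omega>"
    and "semisimple_lie_group G"
    and "smooth_action G M \<alpha>"
    and "moment_map G M \<omega> \<alpha> \<mu>"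
    and "subgroup \<Omega> (outer_aut G)"
    and "\<sigma> \<in> hom (outer_aut G\<lparr>carrier := \<Omega>\<rparr>) (lie_aut G)"
    and "\<forall>w\<in>\<Omega>. \<sigma> w \<in> w"
    and "group_action (outer_aut G\<lparr>carrier := \<Omega>\<rparr>) (points M) \<rho>"
    and "\<forall>w\<in>\<Omega>. symplectomorphism M \<omega> (\<rho> w)"
    and "\<forall>w\<in>\<Omega>. \<forall>g\<in>carrier G. \<forall>x\<in>points M. \<rho> w (\<alpha> g x) = \<alpha> (\<sigma> w g) (\<rho> w x)"
  shows "\<forall>x\<in>points M. \<forall>w\<in>\<Omega>.
           \<mu> (\<rho> w x) = aut_dual G (outer_aut G\<lparr>carrier := \<Omega>\<rparr>) \<sigma> w (\<mu> x)"
proof (intro ballI)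
  fix x w assume x: "x \<in> points M" and w: "w \<in> \<Omega>"
  note \<alpha> = assms(3) and \<mu> = assms(4)
  define W where "W = outer_aut G\<lparr>carrier := \<Omega>\<rparr>"
  have M: "smooth_manifold M" using assms(1) by (simp add: symplectic_manifold_def)
  have lie: "lie_group G" and ss: "semisimple_lie_algebra (lie_bracket G) (lie_algebra G)"
    using assms(2) by (simp_all add: semisimple_lie_group_def)
  have manifold: "smooth_manifold (mfd G)" and one: "\<one>\<^bsub>G\<^esub> \<in> points (mfd G)"
    using lie group.is_monoid monoid.one_closed unfolding lie_group_def by metis+
  obtain c where "c \<in> charts_at (mfd G) \<one>\<^bsub>G\<^esub>" using charts_at_nonempty[OF manifold one] .
  then interpret lie_group_chart G c using lie by unfold_locales
  have W: "group W"
    using group_action.group_hom[OF assms(8)] unfolding W_def group_hom_def by blast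
  have wW: "w \<in> carrier W" using w by (simp add: W_def)
  have \<sigma>: "\<sigma> \<in> hom W (lie_aut G)" using assms(6) by (simp add: W_def)
  let ?v = "inv\<^bsub>W\<^esub> w"
  define s where "s = \<sigma> ?v"
  have v: "?v \<in> carrier W" using group.inv_closed[OF W wW] .
  have s: "s \<in> hom G G" "differentiable_map (mfd G) (mfd G) s"
    using lie_aut_carrier(1,3)[OF hom_in_carrier[OF \<sigma> v]] by (simp_all add: s_def)
  define ds where "ds = tangent_map (mfd G) (mfd G) s \<one>\<^bsub>G\<^esub>"
  \<comment> \<open>\<open>s\<close> is the action of the inverse of \<open>w\<close>, as in the dual action\<close>
  have ds: "ds \<xi> \<in> lie_algebra G" "exp_curve (ds \<xi>) t = s (exp_curve \<xi> t)" if "\<xi> \<in> lie_algebra G" for \<xi> t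
    using endomorphism_exp[OF s(2,1) that] by (simp_all add: ds_def)
  define r where "r = \<rho> w"
  have sympl: "symplectomorphism M \<omega> r" using assms(9) w by (simp add: r_def)
  have r: "differentiable_map M M r"
    using sympl smooth_map_differentiable unfolding symplectomorphism_def by blast
  have rx: "r x \<in> points M" using sympl x bij_betwE unfolding symplectomorphism_def by blast
  have lift: "r (\<alpha> (s g) x) = \<alpha> g (r x)" if g: "g \<in> carrier G" for g
  proof -
    have "r (\<alpha> (s g) x) = \<alpha> (\<sigma> w (s g)) (r x)"
      using assms(10) w x hom_in_carrier[OF s(1) g] unfolding r_def by blast
    then show ?thesis using lie_aut_action_inverse[OF W \<sigma> wW g] by (simp add: s_def)
  qed
  \<comment> \<open>\<open>w\<close> maps the orbit of \<open>x\<close> under \<open>s (exp (t \<xi>))\<close> to that of \<open>w.x\<close> under \<open>exp (t \<xi>)\<close>\<close>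
  have field: "tangent_map M M r x (action_field G M \<alpha> (ds \<xi>) x) = action_field G M \<alpha> \<xi> (r x)"
    if \<xi>: "\<xi> \<in> lie_algebra G" for \<xi>
  proof -
    note curve = action_curve[OF M \<alpha> x ds(1)[OF \<xi>]]
    have "(\<lambda>t. r (\<alpha> (exp_curve (ds \<xi>) t) x)) = (\<lambda>t. \<alpha> (exp_curve \<xi> t) (r x))"
      using lift one_parameter_carrier[OF exp_curve_subgroup[OF \<xi>]] by (simp add: ds(2)[OF \<xi>])
    then have "has_velocity M (\<lambda>t. \<alpha> (exp_curve \<xi> t) (r x)) 0
        (tangent_map M M r x (action_field G M \<alpha> (ds \<xi>) x))"
      using push_velocity(1)[OF M M r curve(2,1)] by (simp only: curve(3))
    then show ?thesis using action_curve(1)[OF M \<alpha> rx \<xi>] by (rule has_velocity_unique)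
  qed
  have tangent: "action_field G M \<alpha> \<xi> x \<in> tangent_space M x" if "\<xi> \<in> lie_algebra G" for \<xi>
    using has_velocity_tangent[OF action_curve(1)[OF M \<alpha> x that]] by (simp only: action_curve(3)[OF M \<alpha> x that])
  define \<phi> where "\<phi> = aut_dual G W \<sigma> w (\<mu> x)"
  have \<phi>_apply: "\<phi> \<zeta> = \<mu> x (ds \<zeta>)" if "\<zeta> \<in> lie_algebra G" for \<zeta>
    using that by (simp add: \<phi>_def aut_dual_def aut_lie_algebra_def ds_def s_def)
  have dual: "\<mu> x \<in> dual_lie_algebra G" "\<mu> (r x) \<in> dual_lie_algebra G"
    using \<mu> x rx by (auto simp: moment_map_def)
  have \<phi>: "\<phi> \<in> dual_lie_algebra G"
    unfolding \<phi>_def by (rule aut_dual_closed[OF lie dual(1)]) (use s in \<open>simp_all add: s_def\<close>)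
  have "\<mu> (r x) (lie_bracket G \<eta> \<xi>) = \<phi> (lie_bracket G \<eta> \<xi>)"
    if \<eta>: "\<eta> \<in> lie_algebra G" and \<xi>: "\<xi> \<in> lie_algebra G" and br: "lie_bracket G \<eta> \<xi> \<in> lie_algebra G" for \<eta> \<xi>
  proof -
    have "\<phi> (Ad G (exp_curve \<eta> (- t)) \<xi>) = \<mu> x (Ad G (exp_curve (ds \<eta>) (- t)) (ds \<xi>))" for t
    proof -
      have g: "exp_curve \<eta> (- t) \<in> carrier G" by (rule one_parameter_carrier[OF exp_curve_subgroup[OF \<eta>]])
      show ?thesis
        using endomorphism_Ad[OF s(2,1) \<xi> g]
        by (simp add: \<phi>_apply[OF Ad_closed[OF g \<xi>]] ds(2)[OF \<eta>] ds_def[symmetric])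
    qed
    then have "((\<lambda>t. \<phi> (Ad G (exp_curve \<eta> (- t)) \<xi>)) has_vector_derivative
        \<omega> x (action_field G M \<alpha> (ds \<xi>) x) (action_field G M \<alpha> (ds \<eta>) x)) (at 0)"
      using moment_map_Ad_derivative[OF M \<alpha> \<mu> x ds(1)[OF \<xi>] ds(1)[OF \<eta>]] by simp
    with lie_bracket_derivative_minus[OF \<xi> \<eta> br \<phi>]
    have "- \<phi> (lie_bracket G \<eta> \<xi>) = \<omega> x (action_field G M \<alpha> (ds \<xi>) x) (action_field G M \<alpha> (ds \<eta>) x)"
      by (rule vector_derivative_unique_at)
    also have "\<dots> = \<omega> (r x) (tangent_map M M r x (action_field G M \<alpha> (ds \<xi>) x))
        (tangent_map M M r x (action_field G M \<alpha> (ds \<eta>) x))"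
      using sympl x tangent[OF ds(1)[OF \<xi>]] tangent[OF ds(1)[OF \<eta>]] unfolding symplectomorphism_def by metis
    also have "\<dots> = - \<mu> (r x) (lie_bracket G \<eta> \<xi>)"
      using moment_map_bracket[OF M \<alpha> \<mu> rx \<xi> \<eta> br] by (simp add: field[OF \<xi>] field[OF \<eta>])
    finally show ?thesis by simp
  qed
  then have "\<mu> (r x) = \<phi>"
    by (intro dual_lie_algebra_eqI[OF manifold dual(2) \<phi> _ semisimple_span_brackets[OF ss]]) auto
  then show "\<mu> (\<rho> w x) = aut_dual G (outer_aut G\<lparr>carrier := \<Omega>\<rparr>) \<sigma> w (\<mu> x)"
    by (simp add: r_def \<phi>_def W_def)
qed

end
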